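(* Let $n \ge 1$ be an integer. For $p \in (0,1]$ and $\alpha > 0$ let $\mu_{p,\alpha}$ be the measure on $\mathbb{R}$ with density $$\mathrm{d}\mu_{p,\alpha}(x) = \frac{\alpha c_p}{2} |x|^{\alpha-1} e^{-|x|^{\alpha p}}\,\mathrm{d}x, \qquad c_p = \frac{1}{\Gamma(1+1/p)}.$$ Then the product measure $\mu_{p,\alpha}^n$ supports the S-inequality for all ideals in $\mathbb{R}^n$. In particular, defining for $\alpha > 0$ and $q \ge 1$ the symmetric Weibull measure $\omega_\alpha$ with parameter $\alpha$ and the symmetric Gamma measure $\lambda_q$ with parameter $q$ on $\mathbb{R}$ by $$\mathrm{d}\omega_\alpha(x) = \frac{1}{2}\alpha |x|^{\alpha-1} e^{-|x|^\alpha}\,\mathrm{d}x, \qquad \mathrm{d}\lambda_q(x) = \frac{1}{2\Gamma(q)} |x|^{q-1} e^{-|x|}\,\mathrm{d}x,$$ the product measures $\omega_\alpha^n$ and $\lambda_q^n$ support the S-inequality for all ideals in $\mathbb{R}^n$.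
   Context: For a Borel measure $\mu$ on $\mathbb{R}$, $\mu^n = \mu^{\otimes n}$ denotes its $n$-fold product measure on $\mathbb{R}^n$. A product measure $\mu^n$ on $\mathbb{R}^n$ supports the S-inequality for a Borel set $L \subset \mathbb{R}^n$ if for any dilation $K = sL$, $s>0$, and any strip $P = \{x \in \mathbb{R}^n : |x_1| \le w\}$ (with $w \ge 0$) we have $$\mu^n(K) = \mu^n(P) \quad\Longrightarrow\quad \mu^n(tK) \ge \mu^n(tP) \ \text{ for all } t \ge 1.$$ A set $K \subset \mathbb{R}^n$ is called an ideal if along with each of its points $x \in K$ it contains the cube $[-|x_1|,|x_1|] \times \cdots \times [-|x_n|,|x_n|]$. "Supports the S-inequality for all ideals" means for every Borel set that is an ideal. *)

theory Defs
  imports "HOL-Analysis.Analysis"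
begin

text \<open>
  Euclidean n-space is modelled, as usual for \<^const>\<open>PiM\<close>, by the functions on {1..n} that are
  extended by \<^const>\<open>undefined\<close> outside {1..n}. Its Borel sets are those of the product
  sigma-algebra of n copies of the Borel sets of the real line.
\<close>

abbreviation Rn :: "nat \<Rightarrow> (nat \<Rightarrow> real) set" where
  "Rn n \<equiv> {1..n} \<rightarrow>\<^sub>E UNIV"

definition borel_sets_Rn :: "nat \<Rightarrow> (nat \<Rightarrow> real) set set" where
  "borel_sets_Rn n = sets (\<Pi>\<^sub>M i\<in>{1..n}. (borel :: real measure))"

definition power_measure :: "real measure \<Rightarrow> nat \<Rightarrow> (nat \<Rightarrow> real) measure" where
  "power_measure \<mu> n = (\<Pi>\<^sub>M i\<in>{1..n}. \<mu>)"

definition dilation :: "nat \<Rightarrow> real \<Rightarrow> (nat \<Rightarrow> real) set \<Rightarrow> (nat \<Rightarrow> real) set" where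
  "dilation n s L = (\<lambda>x. \<lambda>i\<in>{1..n}. s * x i) ` L"

definition strip :: "nat \<Rightarrow> real \<Rightarrow> (nat \<Rightarrow> real) set" where
  "strip n w = {x \<in> Rn n. \<bar>x 1\<bar> \<le> w}"

definition supports_S_inequality :: "real measure \<Rightarrow> nat \<Rightarrow> (nat \<Rightarrow> real) set \<Rightarrow> bool" where
  "supports_S_inequality \<mu> n L \<longleftrightarrow>
     (\<forall>s w. s > 0 \<longrightarrow> w \<ge> 0 \<longrightarrow>
        emeasure (power_measure \<mu> n) (dilation n s L) = emeasure (power_measure \<mu> n) (strip n w) \<longrightarrow>
        (\<forall>t\<ge>1. emeasure (power_measure \<mu> n) (dilation n t (dilation n s L))
                  \<ge> emeasure (power_measure \<mu> n) (dilation n t (strip n w))))"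

definition is_ideal :: "nat \<Rightarrow> (nat \<Rightarrow> real) set \<Rightarrow> bool" where
  "is_ideal n K \<longleftrightarrow>
     K \<subseteq> Rn n \<and> (\<forall>x\<in>K. (\<Pi>\<^sub>E i\<in>{1..n}. {- \<bar>x i\<bar> .. \<bar>x i\<bar>}) \<subseteq> K)"

definition supports_S_inequality_for_ideals :: "real measure \<Rightarrow> nat \<Rightarrow> bool" where
  "supports_S_inequality_for_ideals \<mu> n \<longleftrightarrow>
     (\<forall>L \<in> borel_sets_Rn n. is_ideal n L \<longrightarrow> supports_S_inequality \<mu> n L)"

text \<open>
  In the following densities the value at 0 is immaterial, since a single point is a Lebesgue null
  set; note that 0 powr a = 0 for every a, including a = 0 and negative a.
\<close>

definition c_const :: "real \<Rightarrow> real" where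
  "c_const p = 1 / Gamma (1 + 1 / p)"

definition mu_measure :: "real \<Rightarrow> real \<Rightarrow> real measure" where
  "mu_measure p \<alpha> = density lborel
     (\<lambda>x. ennreal (\<alpha> * c_const p / 2 * \<bar>x\<bar> powr (\<alpha> - 1) * exp (- (\<bar>x\<bar> powr (\<alpha> * p)))))"

definition sym_weibull :: "real \<Rightarrow> real measure" where
  "sym_weibull \<alpha> = density lborel
     (\<lambda>x. ennreal (1 / 2 * \<alpha> * \<bar>x\<bar> powr (\<alpha> - 1) * exp (- (\<bar>x\<bar> powr \<alpha>))))"

definition sym_gamma :: "real \<Rightarrow> real measure" where
  "sym_gamma q = density lborel
     (\<lambda>x. ennreal (1 / (2 * Gamma q) * \<bar>x\<bar> powr (q - 1) * exp (- \<bar>x\<bar>)))"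

end

theory Submission
  imports Defs "HOL-Probability.Probability" "HOL-Real_Asymp.Real_Asymp"
begin

text \<open>
  Under all the measures involved some power of \<open>\<bar>x\<bar>\<close> has a Gamma distribution of shape \<open>k \<ge> 1\<close>
  (\<open>k = 1 / p\<close> for \<open>\<mu>\<^sub>p\<^sub>,\<^sub>\<alpha>\<close>). Let \<open>g\<close> and \<open>P\<close> be its density and distribution function, and let \<open>T\<close>
  map \<open>P q\<close> to \<open>P (t * q)\<close>. For an ideal \<open>L\<close> one shows \<open>\<mu> (t L) \<ge> T (\<mu> L)\<close>, with equality for strips,
  by induction on the dimension. Slicing reduces the step to \<open>\<integral> T (h (x / t)) dP \<ge> T (\<integral> h dP)\<close> for
  antitone \<open>h\<close>, and differentiation in \<open>t\<close> reduces that to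
  \<open>\<Psi> (\<integral> h dP) \<le> \<integral> (\<Psi> (h x) + h x * (k - x)) dP\<close>, where \<open>\<Psi> (P z) = z * g z\<close>.

  Put \<open>\<Phi> = - \<Psi>\<close>; then \<open>\<Phi>' (P z) = z - k\<close> and \<open>1 / \<Phi>'' = g \<circ> P\<^sup>-\<^sup>1\<close>, which is concave because \<open>g\<close> is
  log-concave. Hence the Bregman divergence of \<open>\<Phi>\<close> is jointly convex and the \<open>\<Phi>\<close>-entropy
  \<open>\<integral> \<Phi> (h) dP - \<Phi> (\<integral> h dP)\<close> is convex in \<open>h\<close>. An antitone \<open>h\<close> with values in \<open>[0, 1]\<close> is a mixture of
  indicators of initial intervals, for which the inequality above is an equality.
\<close>

section \<open>The Gamma distribution\<close>

definition gamma_density :: "real \<Rightarrow> real \<Rightarrow> real" where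
  "gamma_density k x = (if x > 0 then x powr (k - 1) * exp (- x) / Gamma k else 0)"

definition gamma_cdf :: "real \<Rightarrow> real \<Rightarrow> real" where
  "gamma_cdf k q = (\<integral>x. indicator {..q} x * gamma_density k x \<partial>lborel)"

lemma gamma_density_nonpos [simp]: "x \<le> 0 \<Longrightarrow> gamma_density k x = 0"
  by (simp add: gamma_density_def)

lemma gamma_density_measurable [measurable]: "gamma_density k \<in> borel_measurable borel"
  unfolding gamma_density_def by measurable

context
  fixes k :: real
  assumes k: "k > 0"
begin

lemma gamma_density_pos: "x > 0 \<Longrightarrow> gamma_density k x > 0"
  using k by (simp add: gamma_density_def Gamma_real_pos)

lemma gamma_density_nonneg [simp]: "gamma_density k x \<ge> 0"
  by (cases "x > 0") (use gamma_density_pos in \<open>auto intro: less_imp_le\<close>)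

lemma gamma_density_has_bochner_integral: "has_bochner_integral lborel (gamma_density k) 1"
proof (rule has_bochner_integral_nn_integral)
  have "(\<integral>\<^sup>+x. ennreal (gamma_density k x) \<partial>lborel) =
    (\<integral>\<^sup>+x. ennreal (1 / Gamma k) * ennreal (indicator {0..} x * x powr (k - 1) / exp x) \<partial>lborel)"
    using k by (intro nn_integral_cong)
      (auto simp: gamma_density_def indicator_def ennreal_mult'[symmetric] exp_minus field_simps Gamma_real_pos less_imp_le)
  also have "\<dots> = ennreal (1 / Gamma k) * ennreal (Gamma k)"
    by (subst nn_integral_cmult) (auto simp: Gamma_conv_nn_integral_real[OF k])
  also have "\<dots> = 1"
    using Gamma_real_pos[OF k] less_imp_neq[OF Gamma_real_pos[OF k]] by (simp flip: ennreal_mult')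
  finally show "(\<integral>\<^sup>+x. ennreal (gamma_density k x) \<partial>lborel) = ennreal 1" by simp
qed auto

lemma gamma_density_integrable [simp, intro]: "integrable lborel (gamma_density k)"
  using gamma_density_has_bochner_integral by (rule integrable.intros)

lemma integral_gamma_density [simp]: "(\<integral>x. gamma_density k x \<partial>lborel) = 1"
  using gamma_density_has_bochner_integral by (rule has_bochner_integral_integral_eq)

text \<open>The bound is asked for positive arguments only, since the density vanishes elsewhere.
  This is the standard source of integrability below.\<close>

lemma integrable_bounded_mult_gamma_density:
  assumes [measurable]: "f \<in> borel_measurable borel" and "\<And>x. x > 0 \<Longrightarrow> \<bar>f x\<bar> \<le> B"
  shows "integrable lborel (\<lambda>x. f x * gamma_density k x)"
proof (rule Bochner_Integration.integrable_bound[of _ "\<lambda>x. B * gamma_density k x"])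
  show "AE x in lborel. norm (f x * gamma_density k x) \<le> norm (B * gamma_density k x)"
  proof (intro always_eventually allI)
    fix x show "norm (f x * gamma_density k x) \<le> norm (B * gamma_density k x)"
      by (cases "x > 0") (auto simp: abs_mult intro!: mult_right_mono assms order_trans[OF assms(2) abs_ge_self])
  qed
qed auto

text \<open>The functional equation of \<open>Gamma\<close>; first moments become integrals of the
  density of shape \<open>k + 1\<close>.\<close>

lemma mult_gamma_density: "x * gamma_density k x = k * gamma_density (k + 1) x"
  using k Gamma_real_pos[OF k] Gamma_plus1[of k]
  by (cases "x > 0") (auto simp: gamma_density_def field_simps powr_mult_base nonpos_Ints_def)

text \<open>The factor \<open>(k - 1) / x - 1\<close> is the logarithmic derivative, which is
  antitone in \<open>x > 0\<close> as soon as \<open>k \<ge> 1\<close>.\<close>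

lemma gamma_density_deriv:
  assumes "x > 0"
  shows "(gamma_density k has_real_derivative gamma_density k x * ((k - 1) / x - 1)) (at x)"
proof -
  have "((\<lambda>x. x powr (k - 1) * exp (- x) / Gamma k) has_real_derivative gamma_density k x * ((k - 1) / x - 1)) (at x)"
    using assms
    by (intro DERIV_cong[OF DERIV_cdivide[OF DERIV_mult[OF has_real_derivative_powr DERIV_chain2[OF DERIV_exp DERIV_minus[OF DERIV_ident]]]]])
       (auto simp: gamma_density_def algebra_simps diff_divide_distrib add_divide_distrib powr_diff power2_eq_square mult_ac)
  moreover have "eventually (\<lambda>x. gamma_density k x = x powr (k - 1) * exp (- x) / Gamma k) (nhds x)"
    using eventually_nhds_in_open[of "{0<..}" x] assms by (auto elim!: eventually_mono simp: gamma_density_def)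
  ultimately show ?thesis by (subst DERIV_cong_ev) auto
qed

lemma gamma_density_isCont: "x > 0 \<Longrightarrow> isCont (gamma_density k) x"
  using DERIV_isCont gamma_density_deriv by blast

text \<open>Divided by the derivative \<open>g\<close> of \<open>P\<close>, this says
  \<open>\<Psi>' (P x) = k - x\<close>.\<close>

lemma mult_gamma_density_deriv:
  assumes "x > 0"
  shows "((\<lambda>x. x * gamma_density k x) has_real_derivative (k - x) * gamma_density k x) (at x)"
  using assms by (auto intro!: derivative_eq_intros gamma_density_deriv simp: field_simps)

lemma mult_gamma_density_at_top: "((\<lambda>x. x * gamma_density k x) \<longlongrightarrow> 0) at_top"
proof -
  have "((\<lambda>x. x * (x powr (k - 1) * exp (- x))) \<longlongrightarrow> 0) at_top"
    using k by real_asymp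
  from tendsto_divide_zero[OF this, of "Gamma k"]
  have "((\<lambda>x. x * (x powr (k - 1) * exp (- x) / Gamma k)) \<longlongrightarrow> 0) at_top"
    by simp
  moreover have "eventually (\<lambda>x. x * gamma_density k x = x * (x powr (k - 1) * exp (- x) / Gamma k)) at_top"
    using eventually_gt_at_top[of 0] by eventually_elim (simp add: gamma_density_def)
  ultimately show ?thesis by (simp add: tendsto_cong)
qed

lemma mult_gamma_density_at_0: "((\<lambda>x. x * gamma_density k x) \<longlongrightarrow> 0) (at_right 0)"
proof -
  have "((\<lambda>x. x * (x powr (k - 1) * exp (- x))) \<longlongrightarrow> 0) (at_right 0)"
    using k by real_asymp
  from tendsto_divide_zero[OF this, of "Gamma k"]
  have "((\<lambda>x. x * (x powr (k - 1) * exp (- x) / Gamma k)) \<longlongrightarrow> 0) (at_right 0)"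
    by simp
  moreover have "eventually (\<lambda>x. x * gamma_density k x = x * (x powr (k - 1) * exp (- x) / Gamma k)) (at_right 0)"
    using eventually_at_right_less[of 0] by eventually_elim (simp add: gamma_density_def)
  ultimately show ?thesis by (simp add: tendsto_cong)
qed

end

lemma integrable_mult_gamma_density [simp]:
  assumes "k > 0"
  shows "integrable lborel (\<lambda>x. x * gamma_density k x)"
  using assms by (simp add: mult_gamma_density)


section \<open>The distribution function: continuity, derivative and range\<close>

lemma gamma_cdf_nonpos [simp]: "q \<le> 0 \<Longrightarrow> gamma_cdf k q = 0"
  unfolding gamma_cdf_def by (rule integral_eq_zero_AE) (auto simp: indicator_def)

context
  fixes k :: real
  assumes k: "k > 0"
begin

lemma integrable_indicator_gamma_density [simp]:
  "A \<in> sets borel \<Longrightarrow> integrable lborel (\<lambda>x. indicator A x * gamma_density k x)"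
  by (rule integrable_bounded_mult_gamma_density[OF k, of _ 1]) (auto simp: indicator_def)

lemma gamma_cdf_nonneg [simp]: "gamma_cdf k q \<ge> 0"
  unfolding gamma_cdf_def by (rule integral_nonneg_AE) (simp add: k)

lemma gamma_cdf_diff:
  assumes "a \<le> b"
  shows "gamma_cdf k b - gamma_cdf k a = (\<integral>x. indicator {a<..b} x * gamma_density k x \<partial>lborel)"
proof -
  have "(\<integral>x. indicator {a<..b} x * gamma_density k x \<partial>lborel)
    = (\<integral>x. indicator {..b} x * gamma_density k x - indicator {..a} x * gamma_density k x \<partial>lborel)"
    using assms by (intro Bochner_Integration.integral_cong) (auto simp: indicator_def)
  thus ?thesis by (simp add: gamma_cdf_def)
qed

lemma gamma_cdf_mono:
  assumes "a \<le> b"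
  shows "gamma_cdf k a \<le> gamma_cdf k b"
proof -
  have "0 \<le> (\<integral>x. indicator {a<..b} x * gamma_density k x \<partial>lborel)"
    by (rule integral_nonneg_AE) (simp add: k)
  then show ?thesis using gamma_cdf_diff[OF assms] by linarith
qed

text \<open>Dominated convergence; the integrands converge at every point but \<open>q\<close>.
  Unlike the derivative rule below, this covers \<open>q = 0\<close>.\<close>

lemma gamma_cdf_isCont: "isCont (gamma_cdf k) q"
  unfolding continuous_within tendsto_at_iff_sequentially comp_def
proof (intro allI impI)
  fix X :: "nat \<Rightarrow> real" assume X: "X \<longlonglongrightarrow> q"
  show "(\<lambda>i. gamma_cdf k (X i)) \<longlonglongrightarrow> gamma_cdf k q"
    unfolding gamma_cdf_def
  proof (rule integral_dominated_convergence[where w = "gamma_density k"])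
    have "(\<lambda>i. indicator {..X i} x * gamma_density k x) \<longlonglongrightarrow> indicator {..q} x * gamma_density k x" if "x \<noteq> q" for x
    proof (rule tendsto_eventually)
      show "eventually (\<lambda>i. indicator {..X i} x * gamma_density k x = indicator {..q} x * gamma_density k x) sequentially"
      proof (cases "x < q")
        case True
        show ?thesis using order_tendstoD(1)[OF X True]
          by eventually_elim (use True in simp)
      next
        case False
        then have "x > q" using that by simp
        show ?thesis using order_tendstoD(2)[OF X \<open>x > q\<close>]
          by eventually_elim (use \<open>x > q\<close> in simp)
      qed
    qed
    moreover have "AE x in lborel. x \<noteq> q" by (rule AE_lborel_singleton)
    ultimately show "AE x in lborel. (\<lambda>i. indicator {..X i} x * gamma_density k x) \<longlonglongrightarrow> indicator {..q} x * gamma_density k x"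
      by (auto elim!: eventually_mono)
  qed (auto simp: k indicator_def)
qed

lemma gamma_cdf_at_top: "(gamma_cdf k \<longlongrightarrow> 1) at_top"
proof -
  have "((\<lambda>t. \<integral>x. indicator {..t} x * gamma_density k x \<partial>lborel) \<longlongrightarrow> (\<integral>x. gamma_density k x \<partial>lborel)) at_top"
  proof (rule integral_dominated_convergence_at_top[where w = "gamma_density k"])
    show "AE x in lborel. ((\<lambda>t. indicator {..t} x * gamma_density k x) \<longlongrightarrow> gamma_density k x) at_top"
    proof (rule AE_I2, rule tendsto_eventually)
      fix x :: real show "eventually (\<lambda>t. indicator {..t} x * gamma_density k x = gamma_density k x) at_top"
        using eventually_ge_at_top[of x] by eventually_elim simp
    qed
  qed (auto simp: k indicator_def intro!: always_eventually)
  thus ?thesis using k by (simp add: gamma_cdf_def[abs_def])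
qed

lemma gamma_cdf_deriv:
  assumes "q > 0"
  shows "(gamma_cdf k has_real_derivative gamma_density k q) (at q)"
proof -
  \<comment> \<open>A compact neighbourhood of \<open>q\<close> that stays away from 0, where the
    density may be discontinuous or unbounded.\<close>
  let ?I = "{q/2..2*q}"
  have cont: "continuous_on ?I (gamma_density k)"
    using assms by (intro continuous_at_imp_continuous_on ballI gamma_density_isCont[OF k]) auto
  have "((\<lambda>x. gamma_cdf k (q/2) + integral {q/2..x} (gamma_density k)) has_real_derivative gamma_density k q) (at q within ?I)"
    using assms cont by (auto intro!: derivative_eq_intros integral_has_real_derivative)
  moreover have "gamma_cdf k (q/2) + integral {q/2..x} (gamma_density k) = gamma_cdf k x" if "x \<in> ?I" for x
  proof -
    have "integral {q/2..x} (gamma_density k) = (LINT y:{q/2..x}|lborel. gamma_density k y)"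
      by (rule set_borel_integral_eq_integral(2)[symmetric]) (auto simp: set_integrable_def)
    also have "\<dots> = (LINT y:{q/2<..x}|lborel. gamma_density k y)"
      unfolding set_lebesgue_integral_def
      using AE_lborel_singleton[of "q/2"]
      by (intro integral_cong_AE) (auto elim!: eventually_mono simp: indicator_def)
    also have "\<dots> = gamma_cdf k x - gamma_cdf k (q/2)"
      using that by (subst gamma_cdf_diff) (auto simp: set_lebesgue_integral_def)
    finally show ?thesis by simp
  qed
  ultimately have "(gamma_cdf k has_real_derivative gamma_density k q) (at q within ?I)"
    using assms by (subst (asm) has_field_derivative_cong_eventually[where g = "gamma_cdf k"])
      (auto simp: eventually_at_filter)
  moreover have "at q within ?I = at q"
    using assms by (intro at_within_interior) (auto simp: interior_atLeastAtMost_real)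
  ultimately show ?thesis by simp
qed

lemma gamma_cdf_strict_mono:
  assumes "0 \<le> a" "a < b"
  shows "gamma_cdf k a < gamma_cdf k b"
  using assms k by (intro DERIV_pos_imp_increasing_open[of a b "gamma_cdf k"])
    (auto intro!: continuous_at_imp_continuous_on gamma_cdf_isCont gamma_cdf_deriv gamma_density_pos exI)

lemma gamma_cdf_le_iff: "0 \<le> a \<Longrightarrow> 0 \<le> b \<Longrightarrow> gamma_cdf k a \<le> gamma_cdf k b \<longleftrightarrow> a \<le> b"
  using gamma_cdf_strict_mono gamma_cdf_mono by (meson leD leI)

lemma gamma_cdf_le_1 [simp]: "gamma_cdf k q \<le> 1"
  using gamma_cdf_at_top by (rule tendsto_lowerbound)
    (auto intro!: gamma_cdf_mono eventually_mono[OF eventually_ge_at_top[of q]])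

lemma gamma_cdf_less_1 [simp]: "gamma_cdf k q < 1"
proof -
  have "gamma_cdf k q \<le> gamma_cdf k (max q 0)" by (rule gamma_cdf_mono) simp
  also have "\<dots> < gamma_cdf k (max q 0 + 1)" by (rule gamma_cdf_strict_mono) auto
  also have "\<dots> \<le> 1" by simp
  finally show ?thesis .
qed

lemma gamma_cdf_pos: "q > 0 \<Longrightarrow> gamma_cdf k q > 0"
  using gamma_cdf_strict_mono[of 0 q] by simp

lemma gamma_cdf_surj:
  assumes "0 \<le> u" "u < 1"
  obtains q where "q \<ge> 0" "gamma_cdf k q = u"
proof -
  have "eventually (\<lambda>x. gamma_cdf k x > u \<and> x \<ge> 0) at_top"
    using order_tendstoD(1)[OF gamma_cdf_at_top assms(2)] eventually_ge_at_top[of 0] by eventually_elim simp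
  then obtain b where "gamma_cdf k b > u" "b \<ge> 0" using eventually_happens by fastforce
  then have "\<exists>x\<ge>0. x \<le> b \<and> gamma_cdf k x = u"
    using assms by (intro IVT) (auto intro: gamma_cdf_isCont)
  then show ?thesis using that by blast
qed

lemma gamma_cdf_measurable [measurable]: "gamma_cdf k \<in> borel_measurable borel"
  by (intro borel_measurable_continuous_onI continuous_at_imp_continuous_on ballI gamma_cdf_isCont)

text \<open>\<open>x * g x\<close> is a primitive of the integrand and tends to 0 at 0. This is the
  equality case of the differential inequality, with \<open>h\<close> the indicator of
  \<open>{..b}\<close>.\<close>

lemma integral_diff_gamma_density_atMost:
  assumes b: "b \<ge> 0"
  shows "(\<integral>x. indicator {..b} x * ((k - x) * gamma_density k x) \<partial>lborel) = b * gamma_density k b"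
proof (cases "b = 0")
  case True
  then show ?thesis by (auto intro!: integral_eq_zero_AE simp: indicator_def)
next
  case False
  then have b: "b > 0" using b by simp
  have int: "integrable lborel (\<lambda>x. (k - x) * gamma_density k x)"
    using k by (simp add: left_diff_distrib)
  \<comment> \<open>The fundamental theorem is used with one-sided limits, since the density need
    not be continuous at 0.\<close>
  have "(LBINT x=0..b. (k - x) * gamma_density k x) = b * gamma_density k b - 0"
  proof (rule interval_integral_FTC_integrable[where F = "\<lambda>x. x * gamma_density k x"])
    show "((\<lambda>x. x * gamma_density k x) has_vector_derivative (k - x) * gamma_density k x) (at x)" if "0 < ereal x" for x
      using mult_gamma_density_deriv[OF k, of x] that by (simp add: has_real_derivative_iff_has_vector_derivative)
    show "isCont (\<lambda>x. (k - x) * gamma_density k x) x" if "0 < ereal x" for x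
      using that k by (auto intro!: continuous_intros gamma_density_isCont)
    show "set_integrable lborel (einterval 0 (ereal b)) (\<lambda>x. (k - x) * gamma_density k x)"
      unfolding set_integrable_def using int by (rule integrable_mult_indicator[rotated]) simp
    show "(((\<lambda>x. x * gamma_density k x) \<circ> real_of_ereal) \<longlongrightarrow> 0) (at_right 0)"
      unfolding zero_ereal_def ereal_tendsto_simps using k by (rule mult_gamma_density_at_0)
    show "(((\<lambda>x. x * gamma_density k x) \<circ> real_of_ereal) \<longlongrightarrow> b * gamma_density k b) (at_left (ereal b))"
      unfolding ereal_tendsto_simps
    proof (rule filterlim_mono[OF _ order_refl at_le])
      show "((\<lambda>x. x * gamma_density k x) \<longlongrightarrow> b * gamma_density k b) (at b)"
        using mult_gamma_density_deriv[OF k b, THEN DERIV_isCont] by (simp add: isCont_def)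
    qed auto
  qed (use b in auto)
  also have "(LBINT x=0..b. (k - x) * gamma_density k x)
     = (\<integral>x. indicator {0<..<b} x * ((k - x) * gamma_density k x) \<partial>lborel)"
    using b by (simp add: interval_lebesgue_integral_def set_lebesgue_integral_def zero_ereal_def)
  also have "\<dots> = (\<integral>x. indicator {..b} x * ((k - x) * gamma_density k x) \<partial>lborel)"
    using AE_lborel_singleton[of b]
    by (intro integral_cong_AE) (auto elim!: eventually_mono simp: indicator_def intro: gamma_density_nonpos leI)
  finally show ?thesis by simp
qed

end

section \<open>Joint convexity of the Bregman divergence\<close>

text \<open>
  The divergence \<open>D(v, u) = \<Phi> v - \<Phi> u - \<phi> u * (v - u)\<close> lies above its tangent plane at \<open>(b, a)\<close>.
  Along the segments from \<open>(u, u)\<close> to \<open>(v, u)\<close> and from \<open>(a, a)\<close> to \<open>(b, a)\<close> the difference of both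
  sides vanishes to first order at the start, and the concavity of \<open>\<psi> = 1 / \<Phi>''\<close> makes its second
  derivative nonnegative.
\<close>

lemma bregman_jointly_convex:
  fixes \<Phi> \<phi> \<psi> \<psi>' :: "real \<Rightarrow> real"
  assumes \<Phi>: "\<And>x. x \<in> {0<..<1} \<Longrightarrow> (\<Phi> has_real_derivative \<phi> x) (at x)"
    and \<phi>: "\<And>x. x \<in> {0<..<1} \<Longrightarrow> (\<phi> has_real_derivative 1 / \<psi> x) (at x)"
    and \<psi>: "\<And>x. x \<in> {0<..<1} \<Longrightarrow> (\<psi> has_real_derivative \<psi>' x) (at x)"
    and pos: "\<And>x. x \<in> {0<..<1} \<Longrightarrow> \<psi> x > 0"
    and concave: "\<And>x y. x \<in> {0<..<1} \<Longrightarrow> y \<in> {0<..<1} \<Longrightarrow> \<psi> y \<le> \<psi> x + \<psi>' x * (y - x)"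
    and u: "u \<in> {0<..<1}" and v: "v \<in> {0<..<1}" and a: "a \<in> {0<..<1}" and b: "b \<in> {0<..<1}"
  shows "\<Phi> b + \<phi> b * (v - b) - \<Phi> a - \<phi> a * (v - a) - (b - a) * (u - a) / \<psi> a
           \<le> \<Phi> v - \<Phi> u - \<phi> u * (v - u)"
proof -
  define V where "V s = u + s * (v - u)" for s
  define B where "B s = a + s * (b - a)" for s
  have seg: "x + s * (y - x) \<in> {0<..<1}" if "s \<in> {0..1}" "x \<in> {0<..<1}" "y \<in> {0<..<1}" for s x y :: real
  proof -
    have "(1 - s) *\<^sub>R x + s *\<^sub>R y \<in> {0<..<1}"
      using convex_real_interval(8)[of 0 1] that unfolding convex_alt by fastforce
    moreover have "(1 - s) *\<^sub>R x + s *\<^sub>R y = x + s * (y - x)" by (simp add: algebra_simps)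
    ultimately show ?thesis by simp
  qed
  have V: "V s \<in> {0<..<1}" and B: "B s \<in> {0<..<1}" if "s \<in> {0..1}" for s
    unfolding V_def B_def using that u v a b by (auto intro!: seg simp del: greaterThanLessThan_iff)
  have dV: "(V has_real_derivative v - u) (at s)" and dB: "(B has_real_derivative b - a) (at s)" for s
    unfolding V_def B_def by (auto intro!: derivative_eq_intros)
  \<comment> \<open>Exactly the value that cancels, in \<open>\<Delta>' 0\<close>, the term coming
    from the derivative of \<open>\<phi> (B s)\<close>.\<close>
  define c where "c = (u - a) / \<psi> a"
  define \<Delta> where "\<Delta> s = \<Phi> (V s) - \<Phi> u - \<phi> u * (V s - u) -
      (\<Phi> (B s) + \<phi> (B s) * (V s - B s) - \<Phi> a - \<phi> a * (V s - a) - (B s - a) * c)" for s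
  define h where "h = v - u"
  define h0 where "h0 = b - a"
  define \<Delta>' where "\<Delta>' s = (\<phi> (V s) - \<phi> u) * h -
      (\<phi> (B s) * h + h0 * ((V s - B s) / \<psi> (B s)) - \<phi> a * h - h0 * c)" for s
  define \<Delta>'' where "\<Delta>'' s = h * h / \<psi> (V s) - (h * h0 / \<psi> (B s) +
      h0 * ((h - h0) * \<psi> (B s) - (V s - B s) * (\<psi>' (B s) * h0)) / (\<psi> (B s) * \<psi> (B s)))" for s
  have d1: "(\<Delta> has_real_derivative \<Delta>' s) (at s)" if "s \<in> {0..1}" for s
    unfolding \<Delta>_def \<Delta>'_def
    by (rule derivative_eq_intros DERIV_chain2[OF \<Phi>[OF V[OF that]] dV] DERIV_chain2[OF \<Phi>[OF B[OF that]] dB]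
        DERIV_chain2[OF \<phi>[OF B[OF that]] dB] dV dB refl)+ (simp add: h_def h0_def algebra_simps)
  have d2: "(\<Delta>' has_real_derivative \<Delta>'' s) (at s)" if "s \<in> {0..1}" for s
  proof -
    have nz: "\<psi> (B s) \<noteq> 0" using pos[OF B[OF that]] by simp
    show ?thesis
      unfolding \<Delta>''_def \<Delta>'_def
      by (rule derivative_eq_intros DERIV_chain2[OF \<phi>[OF V[OF that]] dV] DERIV_chain2[OF \<psi>[OF B[OF that]] dB]
        DERIV_chain2[OF \<phi>[OF B[OF that]] dB] dV dB refl nz)+ (simp add: h_def h0_def mult.commute)
  qed
  have "\<Delta>'' s \<ge> 0" if s: "s \<in> {0..1}" for s
  proof -
    define x where "x = \<psi> (V s)"
    define y where "y = \<psi> (B s)"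
    have xy: "x > 0" "y > 0" using pos[OF B[OF s]] pos[OF V[OF s]] by (auto simp: x_def y_def)
    \<comment> \<open>The tangent of \<open>\<psi>\<close> at \<open>B s\<close>, evaluated at
      \<open>V s\<close>, bounds the only term of \<open>\<Delta>''\<close> that contains
      \<open>\<psi>'\<close>.\<close>
    have "x - y \<le> \<psi>' (B s) * (V s - B s)"
      using concave[OF B[OF s] V[OF s]] by (simp add: x_def y_def)
    then have "h0\<^sup>2 / y\<^sup>2 * (x - y) \<le> h0\<^sup>2 / y\<^sup>2 * (\<psi>' (B s) * (V s - B s))"
      by (rule mult_left_mono) simp
    moreover have "\<Delta>'' s = h\<^sup>2 / x - 2 * h * h0 / y + h0\<^sup>2 / y + h0\<^sup>2 / y\<^sup>2 * (\<psi>' (B s) * (V s - B s))"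
      using xy unfolding \<Delta>''_def x_def[symmetric] y_def[symmetric]
      by (simp add: divide_simps) (simp add: algebra_simps power2_eq_square)
    ultimately have "h\<^sup>2 / x - 2 * h * h0 / y + h0\<^sup>2 / y + h0\<^sup>2 / y\<^sup>2 * (x - y) \<le> \<Delta>'' s"
      by linarith
    \<comment> \<open>After this bound the quadratic form in \<open>h\<close> and \<open>h0\<close>
      degenerates to a perfect square.\<close>
    moreover have "h\<^sup>2 / x - 2 * h * h0 / y + h0\<^sup>2 / y + h0\<^sup>2 / y\<^sup>2 * (x - y) = (h * y - h0 * x)\<^sup>2 / (x * y\<^sup>2)"
      using xy by (simp add: divide_simps) (simp add: algebra_simps power2_eq_square)
    moreover have "(h * y - h0 * x)\<^sup>2 / (x * y\<^sup>2) \<ge> 0" using xy by simp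
    ultimately show ?thesis by linarith
  qed
  note nonneg = this
  \<comment> \<open>Two integrations from 0, where \<open>\<Delta>'\<close> and
    \<open>\<Delta>\<close> both vanish.\<close>
  have "\<Delta>' 0 \<le> \<Delta>' s" if s: "s \<in> {0..1}" for s
  proof (rule DERIV_nonneg_imp_nondecreasing[of 0 s \<Delta>'])
    fix x assume "0 \<le> x" "x \<le> s"
    then have "x \<in> {0..1}" using s by simp
    then show "\<exists>y. (\<Delta>' has_real_derivative y) (at x) \<and> 0 \<le> y" using d2 nonneg by blast
  qed (use s in simp)
  moreover have "\<Delta>' 0 = 0" by (simp add: \<Delta>'_def V_def B_def c_def h0_def)
  ultimately have nonneg': "\<Delta>' s \<ge> 0" if "s \<in> {0..1}" for s
    using that by metis
  have "\<Delta> 0 \<le> \<Delta> 1"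
  proof (rule DERIV_nonneg_imp_nondecreasing[of 0 1 \<Delta>])
    fix x :: real assume "0 \<le> x" "x \<le> 1"
    then have "x \<in> {0..1}" by simp
    then show "\<exists>y. (\<Delta> has_real_derivative y) (at x) \<and> 0 \<le> y" using d1 nonneg' by blast
  qed simp
  moreover have "\<Delta> 0 = 0" by (simp add: \<Delta>_def V_def B_def)
  ultimately show ?thesis by (simp add: \<Delta>_def V_def B_def c_def)
qed

text \<open>
  With \<open>\<Phi> (P z) = - z * g z\<close>, \<open>divergence_0 k z = u * \<Phi>' u - \<Phi> u\<close> and
  \<open>divergence_0 k z + k - z = - \<Phi> u - (1 - u) * \<Phi>' u\<close>
  for \<open>u = gamma_cdf k z\<close>: these are the Bregman divergences from \<open>u\<close> to the endpoints \<open>0\<close> and \<open>1\<close>.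
\<close>

definition divergence_0 :: "real \<Rightarrow> real \<Rightarrow> real" where
  "divergence_0 k z = z * gamma_density k z + (z - k) * gamma_cdf k z"

text \<open>For \<open>0 \<le> u < 1\<close> the choice is unique; \<open>q \<ge> 0\<close> excludes
  the negative points, which all have mass 0. For other \<open>u\<close> no such point exists and
  the value is arbitrary.\<close>

definition gamma_quantile :: "real \<Rightarrow> real \<Rightarrow> real" where
  "gamma_quantile k u = (SOME q. q \<ge> 0 \<and> gamma_cdf k q = u)"

context
  fixes k :: real
  assumes k: "k \<ge> 1"
begin

private lemma k_pos: "k > 0" using k by simp

text \<open>Log-concavity of the density, which is where \<open>k \<ge> 1\<close>, that is \<open>p \<le> 1\<close>, enters.\<close>

lemma gamma_density_below_tangent:
  assumes "r > 0" "s > 0"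
  shows "gamma_density k s \<le> gamma_density k r + ((k - 1) / r - 1) * (gamma_cdf k s - gamma_cdf k r)"
proof -
  \<comment> \<open>The gap between the density, seen as a function of the mass, and its tangent. It
    vanishes at \<open>r\<close>; its derivative is nonpositive before \<open>r\<close> and
    nonnegative after.\<close>
  define F where "F s = gamma_density k r + ((k - 1) / r - 1) * (gamma_cdf k s - gamma_cdf k r) - gamma_density k s" for s
  let ?D = "\<lambda>s. gamma_density k s * (((k - 1) / r - 1) - ((k - 1) / s - 1))"
  have D: "(F has_real_derivative ?D s) (at s)" if "s > 0" for s
    unfolding F_def using that
    by (auto intro!: derivative_eq_intros gamma_cdf_deriv gamma_density_deriv k_pos simp: right_diff_distrib)
  have "F r \<le> F s"
  proof (cases "r \<le> s")
    case True
    show ?thesis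
    proof (rule DERIV_nonneg_imp_nondecreasing[OF True])
      fix x assume "r \<le> x" "x \<le> s"
      then show "\<exists>y. (F has_real_derivative y) (at x) \<and> 0 \<le> y"
        using assms k by (intro exI[of _ "?D x"] conjI D mult_nonneg_nonneg gamma_density_nonneg k_pos)
          (auto intro!: divide_left_mono)
    qed
  next
    case False
    show ?thesis
    proof (rule DERIV_nonpos_imp_nonincreasing[of s r])
      fix x assume "s \<le> x" "x \<le> r"
      then show "\<exists>y. (F has_real_derivative y) (at x) \<and> y \<le> 0"
        using assms k by (intro exI[of _ "?D x"] conjI D mult_nonneg_nonpos gamma_density_nonneg k_pos)
          (auto intro!: divide_left_mono)
    qed (use False in simp)
  qed
  then show ?thesis by (simp add: F_def)
qed

section \<open>The quantile function and the Bregman inequality for the Gamma distribution\<close>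

lemma gamma_quantile:
  assumes "0 \<le> u" "u < 1"
  shows gamma_quantile_nonneg: "gamma_quantile k u \<ge> 0" and gamma_cdf_gamma_quantile: "gamma_cdf k (gamma_quantile k u) = u"
proof -
  obtain q where "q \<ge> 0 \<and> gamma_cdf k q = u" using gamma_cdf_surj[OF k_pos] assms by metis
  then have "gamma_quantile k u \<ge> 0 \<and> gamma_cdf k (gamma_quantile k u) = u" unfolding gamma_quantile_def by (rule someI)
  then show "gamma_quantile k u \<ge> 0" "gamma_cdf k (gamma_quantile k u) = u" by auto
qed

lemma gamma_quantile_pos: "0 < u \<Longrightarrow> u < 1 \<Longrightarrow> gamma_quantile k u > 0"
  using gamma_quantile[of u] gamma_cdf_nonpos[of "gamma_quantile k u" k] by (cases "gamma_quantile k u \<le> 0") auto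

lemma gamma_quantile_gamma_cdf:
  assumes "q \<ge> 0"
  shows "gamma_quantile k (gamma_cdf k q) = q"
proof -
  have "gamma_quantile k (gamma_cdf k q) \<ge> 0" "gamma_cdf k (gamma_quantile k (gamma_cdf k q)) = gamma_cdf k q"
    by (rule gamma_quantile; simp add: k_pos)+
  then show ?thesis using assms gamma_cdf_le_iff[OF k_pos] by (metis antisym order_refl)
qed

lemma gamma_quantile_mono:
  assumes "0 \<le> u" "u \<le> v" "v < 1"
  shows "gamma_quantile k u \<le> gamma_quantile k v"
  using assms gamma_cdf_le_iff[OF k_pos, of "gamma_quantile k u" "gamma_quantile k v"]
  by (simp add: gamma_quantile_nonneg gamma_cdf_gamma_quantile)

text \<open>The inverse function theorem; a mass strictly between 0 and 1 keeps the quantile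
  positive, where the derivative of \<open>gamma_cdf\<close> is known and nonzero.\<close>

lemma gamma_quantile_deriv:
  assumes u: "0 < u" "u < 1"
  shows "(gamma_quantile k has_real_derivative 1 / gamma_density k (gamma_quantile k u)) (at u)"
proof -
  have pos: "gamma_quantile k u > 0" using gamma_quantile_pos u .
  have eq: "gamma_cdf k (gamma_quantile k u) = u" using gamma_cdf_gamma_quantile u by simp
  have "(gamma_quantile k has_derivative (*) (1 / gamma_density k (gamma_quantile k u))) (at (gamma_cdf k (gamma_quantile k u)))"
  proof (rule has_derivative_inverse_strong[where S = "{0<..}" and f = "gamma_cdf k" and x = "gamma_quantile k u"
        and f' = "(*) (gamma_density k (gamma_quantile k u))"])
    show "(gamma_cdf k has_derivative (*) (gamma_density k (gamma_quantile k u))) (at (gamma_quantile k u))"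
      using gamma_cdf_deriv[OF k_pos pos] by (simp add: has_field_derivative_def)
    show "(*) (gamma_density k (gamma_quantile k u)) \<circ> (*) (1 / gamma_density k (gamma_quantile k u)) = id"
      using gamma_density_pos[OF k_pos pos] by (auto simp: fun_eq_iff)
    show "continuous_on {0<..} (gamma_cdf k)"
      by (intro continuous_at_imp_continuous_on ballI gamma_cdf_isCont k_pos)
  qed (use pos gamma_quantile_gamma_cdf in auto)
  then show ?thesis unfolding eq by (simp add: has_field_derivative_def)
qed

text \<open>The abstract inequality at \<open>u = gamma_cdf k z\<close>, \<open>v = gamma_cdf k y\<close>; below \<open>v\<close> tends to \<open>0\<close> and to \<open>1\<close>.\<close>

lemma gamma_bregman:
  assumes z: "z > 0" and y: "y > 0" and a: "a > 0" and b: "b > 0"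
  shows "- (b * gamma_density k b) + (b - k) * (gamma_cdf k y - gamma_cdf k b) - (- (a * gamma_density k a))
      - (a - k) * (gamma_cdf k y - gamma_cdf k a) - (gamma_cdf k b - gamma_cdf k a) * (gamma_cdf k z - gamma_cdf k a) / gamma_density k a
    \<le> - (y * gamma_density k y) - (- (z * gamma_density k z)) - (z - k) * (gamma_cdf k y - gamma_cdf k z)"
proof -
  define Q where "Q = gamma_quantile k"
  have Q: "Q u > 0 \<and> gamma_cdf k (Q u) = u" if u: "u \<in> {0<..<1}" for u
    using gamma_quantile_pos[of u] gamma_cdf_gamma_quantile[of u] u by (simp add: Q_def)
  have P01: "gamma_cdf k q \<in> {0<..<1}" if "q > 0" for q
    using that gamma_cdf_pos[OF k_pos] gamma_cdf_less_1[OF k_pos] by simp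
  have QP: "Q (gamma_cdf k q) = q" if "q > 0" for q
    using that by (simp add: Q_def gamma_quantile_gamma_cdf)
  have dQ: "(Q has_real_derivative 1 / gamma_density k (Q u)) (at u)" if "u \<in> {0<..<1}" for u
    using that gamma_quantile_deriv[of u] by (simp add: Q_def)
  have g: "gamma_density k (Q u) > 0" if "u \<in> {0<..<1}" for u
    using Q[OF that] gamma_density_pos[OF k_pos] by blast
  \<comment> \<open>Every point is written as the quantile of its mass, so that the abstract lemma
    applies with \<open>\<Phi> = - \<Psi>\<close> and \<open>\<psi> = g \<circ> Q\<close>.\<close>
  have "- (Q (gamma_cdf k b) * gamma_density k (Q (gamma_cdf k b))) + (Q (gamma_cdf k b) - k) * (gamma_cdf k y - gamma_cdf k b)
      - (- (Q (gamma_cdf k a) * gamma_density k (Q (gamma_cdf k a))))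
      - (Q (gamma_cdf k a) - k) * (gamma_cdf k y - gamma_cdf k a) - (gamma_cdf k b - gamma_cdf k a) * (gamma_cdf k z - gamma_cdf k a) / gamma_density k (Q (gamma_cdf k a))
    \<le> - (Q (gamma_cdf k y) * gamma_density k (Q (gamma_cdf k y))) - (- (Q (gamma_cdf k z) * gamma_density k (Q (gamma_cdf k z))))
      - (Q (gamma_cdf k z) - k) * (gamma_cdf k y - gamma_cdf k z)"
  proof (rule bregman_jointly_convex[where \<psi>' = "\<lambda>u. (k - 1) / Q u - 1" and \<psi> = "\<lambda>u. gamma_density k (Q u)"
      and \<Phi> = "\<lambda>u. - (Q u * gamma_density k (Q u))" and \<phi> = "\<lambda>u. Q u - k"])
    fix u :: real assume u: "u \<in> {0<..<1}"
    have q: "Q u > 0" using Q[OF u] by simp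
    \<comment> \<open>Here and in the derivative of \<open>\<psi>\<close> the factor
      \<open>1 / g\<close> from the quantile cancels the density.\<close>
    show "((\<lambda>u. - (Q u * gamma_density k (Q u))) has_real_derivative Q u - k) (at u)"
      using DERIV_minus[OF DERIV_chain2[OF mult_gamma_density_deriv[OF k_pos q] dQ[OF u]]] g[OF u] by simp
    show "((\<lambda>u. Q u - k) has_real_derivative 1 / gamma_density k (Q u)) (at u)"
      using DERIV_diff[OF dQ[OF u] DERIV_const] by simp
    show "((\<lambda>u. gamma_density k (Q u)) has_real_derivative (k - 1) / Q u - 1) (at u)"
      using DERIV_chain2[OF gamma_density_deriv[OF k_pos q] dQ[OF u]] g[OF u] by simp
    fix v :: real assume v: "v \<in> {0<..<1}"
    show "gamma_density k (Q v) \<le> gamma_density k (Q u) + ((k - 1) / Q u - 1) * (v - u)"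
      using gamma_density_below_tangent[of "Q u" "Q v"] Q[OF u] Q[OF v] by simp
  qed (use assms P01 g in auto)
  then show ?thesis using assms by (simp only: QP)
qed

section \<open>Limits of the Bregman inequality at the endpoints 0 and 1\<close>

lemma gamma_cdf_tendsto_0: "(gamma_cdf k \<longlongrightarrow> 0) (at_right 0)"
  using gamma_cdf_isCont[OF k_pos, of 0] by (simp add: isCont_def filterlim_at_split)

lemma divergence_0_tendsto_0: "(divergence_0 k \<longlongrightarrow> 0) (at_right 0)"
proof -
  have "((\<lambda>z. z * gamma_density k z + (z - k) * gamma_cdf k z) \<longlongrightarrow> 0 + (0 - k) * 0) (at_right 0)"
    by (intro tendsto_intros mult_gamma_density_at_0 gamma_cdf_tendsto_0 k_pos)
  then show ?thesis by (simp add: divergence_0_def[abs_def])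
qed

lemma divergence_0_0 [simp]: "divergence_0 k 0 = 0"
  by (simp add: divergence_0_def)

text \<open>The limit of \<open>gamma_bregman\<close> as \<open>y\<close>, and with it
  \<open>v\<close>, tends to 0: the right side becomes the divergence between the endpoint 0 and the
  mass of \<open>z\<close>.\<close>

lemma tangent_0:
  assumes z: "z \<ge> 0" and a: "a > 0" and b: "b > 0"
  shows "divergence_0 k a - divergence_0 k b - (gamma_cdf k b - gamma_cdf k a) * (gamma_cdf k z - gamma_cdf k a) / gamma_density k a \<le> divergence_0 k z"
    (is "?L z \<le> _")
proof -
  have pos: "?L z \<le> divergence_0 k z" if z: "z > 0" for z
  proof (rule tendsto_le[where F = "at_right 0"])
    let ?f = "\<lambda>y. - (b * gamma_density k b) + (b - k) * (gamma_cdf k y - gamma_cdf k b) - (- (a * gamma_density k a))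
      - (a - k) * (gamma_cdf k y - gamma_cdf k a) - (gamma_cdf k b - gamma_cdf k a) * (gamma_cdf k z - gamma_cdf k a) / gamma_density k a"
    let ?h = "\<lambda>y. - (y * gamma_density k y) - (- (z * gamma_density k z)) - (z - k) * (gamma_cdf k y - gamma_cdf k z)"
    note c = gamma_cdf_tendsto_0
    have "(?f \<longlongrightarrow> - (b * gamma_density k b) + (b - k) * (0 - gamma_cdf k b) - (- (a * gamma_density k a))
      - (a - k) * (0 - gamma_cdf k a) - (gamma_cdf k b - gamma_cdf k a) * (gamma_cdf k z - gamma_cdf k a) / gamma_density k a) (at_right 0)"
      using gamma_density_pos[OF k_pos a] by (intro tendsto_intros c) auto
    then show "(?f \<longlongrightarrow> ?L z) (at_right 0)" by (simp add: divergence_0_def algebra_simps)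
    have "(?h \<longlongrightarrow> - 0 - (- (z * gamma_density k z)) - (z - k) * (0 - gamma_cdf k z)) (at_right 0)"
      by (intro tendsto_intros c mult_gamma_density_at_0 k_pos)
    then show "(?h \<longlongrightarrow> divergence_0 k z) (at_right 0)" by (simp add: divergence_0_def algebra_simps)
    show "eventually (\<lambda>y. ?f y \<le> ?h y) (at_right 0)"
      using eventually_at_right_less[of 0] by eventually_elim (rule gamma_bregman; use z a b in simp)
  qed simp
  \<comment> \<open>\<open>gamma_bregman\<close> needs \<open>u\<close> inside the open unit
    interval; \<open>z = 0\<close> follows by right continuity of both sides.\<close>
  have "?L 0 \<le> divergence_0 k 0"
  proof (rule tendsto_le[where F = "at_right 0"])
    have c: "(gamma_cdf k \<longlongrightarrow> gamma_cdf k 0) (at_right 0)"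
      using gamma_cdf_tendsto_0 by simp
    show "((\<lambda>z. ?L z) \<longlongrightarrow> ?L 0) (at_right 0)"
      using gamma_density_pos[OF k_pos a] by (intro tendsto_intros c) auto
    show "(divergence_0 k \<longlongrightarrow> divergence_0 k 0) (at_right 0)" using divergence_0_tendsto_0 by simp
    show "eventually (\<lambda>z. ?L z \<le> divergence_0 k z) (at_right 0)"
      using eventually_at_right_less[of 0] by eventually_elim (rule pos)
  qed simp
  then show ?thesis using pos z by (cases "z = 0") auto
qed

text \<open>The same with \<open>y\<close> tending to infinity, so that \<open>v\<close> tends to 1;
  the boundary term \<open>y * g y\<close> disappears again.\<close>

lemma tangent_1:
  assumes z: "z \<ge> 0" and a: "a > 0" and b: "b > 0"
  shows "(divergence_0 k a + k - a) - (divergence_0 k b + k - b)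
    - (gamma_cdf k b - gamma_cdf k a) * (gamma_cdf k z - gamma_cdf k a) / gamma_density k a \<le> divergence_0 k z + k - z"
    (is "?L z \<le> _")
proof -
  have pos: "?L z \<le> divergence_0 k z + k - z" if z: "z > 0" for z
  proof (rule tendsto_le[where F = "at_top"])
    let ?f = "\<lambda>y. - (b * gamma_density k b) + (b - k) * (gamma_cdf k y - gamma_cdf k b) - (- (a * gamma_density k a))
      - (a - k) * (gamma_cdf k y - gamma_cdf k a) - (gamma_cdf k b - gamma_cdf k a) * (gamma_cdf k z - gamma_cdf k a) / gamma_density k a"
    let ?h = "\<lambda>y. - (y * gamma_density k y) - (- (z * gamma_density k z)) - (z - k) * (gamma_cdf k y - gamma_cdf k z)"
    note c = gamma_cdf_at_top[OF k_pos]
    have "(?f \<longlongrightarrow> - (b * gamma_density k b) + (b - k) * (1 - gamma_cdf k b) - (- (a * gamma_density k a))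
      - (a - k) * (1 - gamma_cdf k a) - (gamma_cdf k b - gamma_cdf k a) * (gamma_cdf k z - gamma_cdf k a) / gamma_density k a) at_top"
      using gamma_density_pos[OF k_pos a] by (intro tendsto_intros c) auto
    then show "(?f \<longlongrightarrow> ?L z) at_top" by (simp add: divergence_0_def algebra_simps)
    have "(?h \<longlongrightarrow> - 0 - (- (z * gamma_density k z)) - (z - k) * (1 - gamma_cdf k z)) at_top"
      by (intro tendsto_intros c mult_gamma_density_at_top k_pos)
    then show "(?h \<longlongrightarrow> divergence_0 k z + k - z) at_top" by (simp add: divergence_0_def algebra_simps)
    show "eventually (\<lambda>y. ?f y \<le> ?h y) at_top"
      using eventually_gt_at_top[of 0] by eventually_elim (rule gamma_bregman; use z a b in simp)
  qed simp
  have "?L 0 \<le> divergence_0 k 0 + k - 0"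
  proof (rule tendsto_le[where F = "at_right 0"])
    have c: "(gamma_cdf k \<longlongrightarrow> gamma_cdf k 0) (at_right 0)"
      using gamma_cdf_tendsto_0 by simp
    show "((\<lambda>z. ?L z) \<longlongrightarrow> ?L 0) (at_right 0)"
      using gamma_density_pos[OF k_pos a] by (intro tendsto_intros c) auto
    have "((\<lambda>z. divergence_0 k z + k - z) \<longlongrightarrow> 0 + k - 0) (at_right 0)"
      by (intro tendsto_intros divergence_0_tendsto_0)
    then show "((\<lambda>z. divergence_0 k z + k - z) \<longlongrightarrow> divergence_0 k 0 + k - 0) (at_right 0)" by simp
    show "eventually (\<lambda>z. ?L z \<le> divergence_0 k z + k - z) (at_right 0)"
      using eventually_at_right_less[of 0] by eventually_elim (rule pos)
  qed simp
  then show ?thesis using pos z by (cases "z = 0") auto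
qed

end

section \<open>The differential inequality\<close>

lemma antimono_borel_measurable:
  fixes f :: "real \<Rightarrow> real"
  assumes "antimono f"
  shows "f \<in> borel_measurable borel"
proof -
  have "mono (\<lambda>x. - f x)" using assms by (auto simp: mono_def antimono_def)
  from borel_measurable_mono[OF this] have "(\<lambda>x. - (- f x)) \<in> borel_measurable borel"
    by (rule borel_measurable_uminus)
  then show ?thesis by simp
qed

lemma layer_cake_lower_bound:
  fixes h l :: "real \<Rightarrow> real"
  assumes h: "antimono h" "\<And>x. 0 \<le> h x" "\<And>x. h x \<le> 1"
    and l: "integrable lborel l"
    and C: "\<And>A. A \<in> sets borel \<Longrightarrow> (\<And>x y. x \<in> A \<Longrightarrow> y \<le> x \<Longrightarrow> y \<in> A) \<Longrightarrow>
              C \<le> (\<integral>x. indicator A x * l x \<partial>lborel)"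
  shows "C \<le> (\<integral>x. h x * l x \<partial>lborel)"
proof -
  have [measurable]: "h \<in> borel_measurable borel" "l \<in> borel_measurable borel"
    using antimono_borel_measurable[OF h(1)] l by auto
  define f where "f x t = indicator {0..<1} t * (indicator {y. t < h y} x * l x)" for x t :: real
  have f_meas [measurable]: "case_prod f \<in> borel_measurable (lborel \<Otimes>\<^sub>M lborel)"
    unfolding f_def indicator_def by simp
  have inner: "(\<integral>t. indicator {0..<1} t * indicator {y. t < h y} x * c \<partial>lborel) = h x * c" for x c
  proof -
    have "(\<integral>t. indicator {0..<1} t * indicator {y. t < h y} x * c \<partial>lborel)
      = (\<integral>t. indicator {0..<h x} t * c \<partial>lborel)"
      using h(2,3)[of x] by (intro Bochner_Integration.integral_cong) (auto simp: indicator_def)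
    then show ?thesis using h(2)[of x] by simp
  qed
  have int: "integrable (lborel \<Otimes>\<^sub>M lborel) (case_prod f)"
  proof (rule lborel_pair.Fubini_integrable[OF f_meas])
    have "(\<lambda>x. \<integral>t. norm (case_prod f (x, t)) \<partial>lborel) = (\<lambda>x. h x * \<bar>l x\<bar>)"
      unfolding inner[symmetric] by (auto simp: f_def abs_mult mult.assoc)
    moreover have "integrable lborel (\<lambda>x. h x * \<bar>l x\<bar>)"
      using h(2,3) by (intro Bochner_Integration.integrable_bound[OF l] AE_I2)
        (auto simp: abs_mult intro!: mult_left_le_one_le)
    ultimately show "integrable lborel (\<lambda>x. \<integral>t. norm (case_prod f (x, t)) \<partial>lborel)" by simp
    have "integrable lborel (\<lambda>t. f x t)" for x
    proof (rule Bochner_Integration.integrable_bound[of _ "\<lambda>t. indicator {0..<1} t * l x"])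
      show "integrable lborel (\<lambda>t. indicator {0..<1::real} t * l x)"
        by (intro integrable_mult_left integrable_real_indicator) auto
    qed (auto simp: f_def indicator_def intro!: AE_I2)
    then show "AE x in lborel. integrable lborel (\<lambda>t. case_prod f (x, t))" by simp
  qed
  \<comment> \<open>The levels have total length 1, so the constant survives the averaging.\<close>
  have "C = (\<integral>t. indicator {0..<1::real} t * C \<partial>lborel)" by simp
  also have "\<dots> \<le> (\<integral>t. (\<integral>x. f x t \<partial>lborel) \<partial>lborel)"
  proof (rule integral_mono)
    show "integrable lborel (\<lambda>t. indicator {0..<1::real} t * C)"
      by (intro integrable_mult_left integrable_real_indicator) auto
    show "integrable lborel (\<lambda>t. \<integral>x. f x t \<partial>lborel)"
      by (rule lborel_pair.integrable_snd[OF int])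
    fix t :: real
    have "C \<le> (\<integral>x. indicator {y. t < h y} x * l x \<partial>lborel)"
    proof (rule C)
      fix x y assume "x \<in> {y. t < h y}" "y \<le> x"
      then show "y \<in> {y. t < h y}" using antimonoD[OF h(1), of y x] by auto
    qed measurable
    then show "indicator {0..<1} t * C \<le> (\<integral>x. f x t \<partial>lborel)"
      by (simp add: f_def indicator_def)
  qed
  also have "\<dots> = (\<integral>x. (\<integral>t. f x t \<partial>lborel) \<partial>lborel)"
    by (rule lborel_pair.Fubini_integral[OF int])
  also have "\<dots> = (\<integral>x. h x * l x \<partial>lborel)"
    using inner by (simp add: f_def mult.assoc)
  finally show ?thesis .
qed

text \<open>In the third case membership of the boundary point is left open; a single point is a
  null set for the integrals.\<close>

lemma down_closed_real_cases:
  fixes A :: "real set"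
  assumes "\<And>x y. x \<in> A \<Longrightarrow> y \<le> x \<Longrightarrow> y \<in> A"
  obtains "A = {}" | "A = UNIV" | w where "{..<w} \<subseteq> A" "A \<subseteq> {..w}"
proof (cases "A = {} \<or> \<not> bdd_above A")
  case True
  have "A = UNIV" if "\<not> bdd_above A"
  proof (intro equalityI subsetI UNIV_I)
    fix x show "x \<in> A" using that assms unfolding bdd_above_def by (meson linear)
  qed
  then show ?thesis using True that(1,2) by metis
next
  case False
  have "{..<Sup A} \<subseteq> A"
  proof
    fix x assume "x \<in> {..<Sup A}"
    then obtain y where "y \<in> A" "x < y" using False less_cSupE[of x A] by auto
    then show "x \<in> A" using assms by (meson less_imp_le)
  qed
  moreover have "A \<subseteq> {..Sup A}" using False by (auto intro: cSup_upper)
  ultimately show ?thesis using that by blast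
qed

section \<open>Integration of the tangent inequalities\<close>

context
  fixes k :: real
  assumes k1: "k \<ge> 1"
begin

private lemma k0: "k > 0" using k1 by simp

text \<open>The integral of \<open>(k - x) * g x\<close> over \<open>{..b}\<close> is at most that
  of \<open>k * g x\<close> over the line. The bound is uniform in \<open>b\<close> and serves for
  majorants below.\<close>

lemma mult_gamma_density_le:
  assumes "b \<ge> 0"
  shows "b * gamma_density k b \<le> k"
proof -
  have "b * gamma_density k b = (\<integral>x. indicator {..b} x * ((k - x) * gamma_density k x) \<partial>lborel)"
    using integral_diff_gamma_density_atMost[OF k0 assms] by simp
  also have "\<dots> \<le> (\<integral>x. k * gamma_density k x \<partial>lborel)"
  proof (rule integral_mono)
    have "integrable lborel (\<lambda>x. (k - x) * gamma_density k x)" using k0 by (simp add: left_diff_distrib)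
    then have "integrable lborel (\<lambda>x. indicator {..b} x *\<^sub>R ((k - x) * gamma_density k x))"
      by (rule integrable_mult_indicator[rotated]) simp
    then show "integrable lborel (\<lambda>x. indicator {..b} x * ((k - x) * gamma_density k x))" by simp
    fix x show "indicator {..b} x * ((k - x) * gamma_density k x) \<le> k * gamma_density k x"
      using k0 by (cases "x > 0") (auto simp: indicator_def intro!: mult_right_mono)
  qed (use k0 in simp)
  also have "\<dots> = k" using k0 by simp
  finally show ?thesis .
qed

lemma abs_divergence_0_le:
  assumes "0 \<le> z" "z \<le> Z"
  shows "\<bar>divergence_0 k z\<bar> \<le> 2 * k + Z"
proof -
  have "\<bar>z - k\<bar> * gamma_cdf k z \<le> (Z + k) * 1"
    using assms k0 by (intro mult_mono) auto
  moreover have "\<bar>divergence_0 k z\<bar> \<le> \<bar>z * gamma_density k z\<bar> + \<bar>(z - k) * gamma_cdf k z\<bar>"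
    unfolding divergence_0_def by (rule abs_triangle_ineq)
  ultimately show ?thesis using assms mult_gamma_density_le[of z] k0 by (simp add: abs_mult)
qed

text \<open>
  The right-hand side below is the derivative with respect to \<open>ln t\<close> of the mass of a dilated
  two-dimensional ideal, \<open>a * gamma_density k a\<close> that of the strip of the same mass. The tangent inequalities are
  integrated with \<open>v\<close> the indicator of \<open>x \<le> b\<close>, and the result, \<open>C \<le> L b\<close>, is averaged over \<open>b\<close>.
\<close>

lemma key_inequality:
  assumes z: "antimono z" "\<And>x. 0 \<le> z x" "\<And>x. z x \<le> Z"
    and a: "a > 0" "gamma_cdf k a = (\<integral>x. gamma_cdf k (z x) * gamma_density k x \<partial>lborel)"
  shows "a * gamma_density k a \<le> (\<integral>x. (z x * gamma_density k (z x) + gamma_cdf k (z x) * (k - x)) * gamma_density k x \<partial>lborel)"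
proof -
  have zm [measurable]: "z \<in> borel_measurable borel" by (rule antimono_borel_measurable[OF z(1)])
  note [measurable] = gamma_cdf_measurable[OF k0]
  have gKm [measurable]: "divergence_0 k \<in> borel_measurable borel" unfolding divergence_0_def[abs_def] by measurable
  note bnd = integrable_bounded_mult_gamma_density[OF k0]
  have int_divergence_0: "integrable lborel (\<lambda>x. divergence_0 k (z x) * gamma_density k x)"
    by (rule bnd[where B = "2 * k + Z"]) (use z abs_divergence_0_le in auto)
  have int_P: "integrable lborel (\<lambda>x. gamma_cdf k (z x) * gamma_density k x)"
    by (rule bnd[where B = 1]) (use k0 in auto)
  have int_z: "integrable lborel (\<lambda>x. z x * gamma_density k x)"
    by (rule bnd[where B = Z]) (use z in auto)
  have int_Iz: "integrable lborel (\<lambda>x. indicator A x * z x * gamma_density k x)" if [measurable]: "A \<in> sets borel" for A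
    by (rule bnd[where B = Z]) (use z order_trans[OF z(2,3)] in \<open>auto simp: indicator_def\<close>)
  have int_Pz: "integrable lborel (\<lambda>x. gamma_cdf k (z x) * z x * gamma_density k x)"
  proof (rule bnd[where B = Z])
    fix x :: real
    have "gamma_cdf k (z x) * z x \<le> 1 * Z" using z(2,3)[of x] k0 by (intro mult_mono) auto
    then show "\<bar>gamma_cdf k (z x) * z x\<bar> \<le> Z" using z(2)[of x] k0 by simp
  qed measurable
  have int_zg: "integrable lborel (\<lambda>x. z x * gamma_density k (z x) * gamma_density k x)"
    by (rule bnd[where B = k]) (use z k0 mult_gamma_density_le in auto)
  have int_Px: "integrable lborel (\<lambda>x. gamma_cdf k (z x) * (x * gamma_density k x))"
    using k0 by (intro Bochner_Integration.integrable_bound[OF integrable_mult_gamma_density[OF k0]] AE_I2)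
      (auto simp: abs_mult intro!: mult_left_le_one_le mult_nonneg_nonneg)
  \<comment> \<open>Integrating the tangent inequalities will give \<open>C \<le> L b\<close>:
    \<open>C\<close> collects what is free of \<open>b\<close>, and \<open>l\<close> is the
    integrand whose integral up to \<open>b\<close> is \<open>L b\<close>.\<close>
  define l where "l x = (k - x + a - z x) * gamma_density k x" for x
  define L where "L b = b * gamma_density k b + a * gamma_cdf k b - (\<integral>x. indicator {..b} x * z x * gamma_density k x \<partial>lborel)" for b
  define C where "C = divergence_0 k a - (\<integral>x. divergence_0 k (z x) * gamma_density k x \<partial>lborel)"
  have l_alt: "l x = (k - x) * gamma_density k x + a * gamma_density k x - z x * gamma_density k x" for x
    by (simp add: l_def algebra_simps)
  have int_kx: "integrable lborel (\<lambda>x. (k - x) * gamma_density k x)" using k0 by (simp add: left_diff_distrib)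
  have int_Ikx: "integrable lborel (\<lambda>x. indicator A x * ((k - x) * gamma_density k x))" if "A \<in> sets borel" for A
    using integrable_mult_indicator[OF _ int_kx, of A] that by simp
  have int_l: "integrable lborel l" unfolding l_alt[abs_def] using k0 int_z int_kx by simp
  have L_eq: "(\<integral>x. indicator {..b} x * l x \<partial>lborel) = L b" if b: "b > 0" for b
  proof -
    have "(\<integral>x. indicator {..b} x * l x \<partial>lborel) = (\<integral>x. indicator {..b} x * ((k - x) * gamma_density k x)
        + a * (indicator {..b} x * gamma_density k x) - indicator {..b} x * z x * gamma_density k x \<partial>lborel)"
      by (intro Bochner_Integration.integral_cong) (auto simp: l_def algebra_simps)
    also have "\<dots> = L b"
      using int_Ikx int_Iz k0 integral_diff_gamma_density_atMost[OF k0, of b] b by (simp add: L_def gamma_cdf_def)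
    finally show ?thesis .
  qed
  have L_ge: "C \<le> L b" if b: "b > 0" for b
  proof -
    \<comment> \<open>The tangent point is \<open>(P b, P a)\<close>. For \<open>x \<le> b\<close>
      the indicator is 1 and \<open>tangent_1\<close> applies; for \<open>x > b\<close> it is 0 and
      \<open>tangent_0\<close> applies.\<close>
    have "(\<integral>x. (divergence_0 k a - divergence_0 k b) * gamma_density k x + (b - a) * (indicator {..b} x * gamma_density k x)
        - (gamma_cdf k b - gamma_cdf k a) / gamma_density k a * (gamma_cdf k (z x) * gamma_density k x - gamma_cdf k a * gamma_density k x) \<partial>lborel)
      \<le> (\<integral>x. divergence_0 k (z x) * gamma_density k x + k * (indicator {..b} x * gamma_density k x) - indicator {..b} x * z x * gamma_density k x \<partial>lborel)"
    proof (rule integral_mono)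
      fix x
      show "(divergence_0 k a - divergence_0 k b) * gamma_density k x + (b - a) * (indicator {..b} x * gamma_density k x)
        - (gamma_cdf k b - gamma_cdf k a) / gamma_density k a * (gamma_cdf k (z x) * gamma_density k x - gamma_cdf k a * gamma_density k x)
       \<le> divergence_0 k (z x) * gamma_density k x + k * (indicator {..b} x * gamma_density k x) - indicator {..b} x * z x * gamma_density k x"
        using mult_right_mono[OF tangent_0[OF k1 z(2) a(1) b], of "gamma_density k x" x]
          mult_right_mono[OF tangent_1[OF k1 z(2) a(1) b], of "gamma_density k x" x] k0
        by (cases "x \<le> b") (auto simp: algebra_simps diff_divide_distrib add_divide_distrib)
    qed (use k0 int_P int_divergence_0 int_Iz in auto)
    also have "\<dots> = (\<integral>x. divergence_0 k (z x) * gamma_density k x \<partial>lborel) + k * gamma_cdf k b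
        - (\<integral>x. indicator {..b} x * z x * gamma_density k x \<partial>lborel)"
      using k0 int_divergence_0 int_Iz by (simp add: gamma_cdf_def)
    \<comment> \<open>The term linear in \<open>P (z x) - P a\<close> integrates to 0, because
      \<open>P a\<close> is the mean of \<open>P (z x)\<close>.\<close>
    also have "(\<integral>x. (divergence_0 k a - divergence_0 k b) * gamma_density k x + (b - a) * (indicator {..b} x * gamma_density k x)
        - (gamma_cdf k b - gamma_cdf k a) / gamma_density k a * (gamma_cdf k (z x) * gamma_density k x - gamma_cdf k a * gamma_density k x) \<partial>lborel)
       = divergence_0 k a - divergence_0 k b + (b - a) * gamma_cdf k b"
      using k0 int_P by (simp add: a(2)[symmetric]) (simp add: gamma_cdf_def)
    finally show ?thesis by (simp add: C_def L_def divergence_0_def[of k b] algebra_simps)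
  qed
  \<comment> \<open>The case of the empty set, as the limit of \<open>C \<le> L b\<close> at 0; then
    that of the whole line, as the limit at infinity.\<close>
  have C_0: "C \<le> 0"
  proof (rule tendsto_lowerbound[where F = "at_right 0" and f = L])
    have "((\<lambda>b. \<integral>x. indicator {..b} x * z x * gamma_density k x \<partial>lborel) \<longlongrightarrow> 0) (at_right 0)"
    proof (rule tendsto_sandwich[where f = "\<lambda>_. 0" and h = "\<lambda>b. Z * gamma_cdf k b"])
      show "((\<lambda>b. Z * gamma_cdf k b) \<longlongrightarrow> 0) (at_right 0)"
        using tendsto_mult_right_zero[OF gamma_cdf_tendsto_0[OF k1]] by simp
      have "(\<integral>x. indicator {..b} x * z x * gamma_density k x \<partial>lborel) \<le> (\<integral>x. Z * (indicator {..b} x * gamma_density k x) \<partial>lborel)" for b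
      proof (rule integral_mono)
        fix x show "indicator {..b} x * z x * gamma_density k x \<le> Z * (indicator {..b} x * gamma_density k x)"
          using z(3)[of x] k0 by (cases "x \<le> b") (auto intro!: mult_right_mono)
      qed (use k0 int_Iz in simp_all)
      then show "eventually (\<lambda>b. (\<integral>x. indicator {..b} x * z x * gamma_density k x \<partial>lborel) \<le> Z * gamma_cdf k b) (at_right 0)"
        by (intro always_eventually allI) (simp add: gamma_cdf_def)
      show "eventually (\<lambda>b. 0 \<le> (\<integral>x. indicator {..b} x * z x * gamma_density k x \<partial>lborel)) (at_right 0)"
        using z k0 by (intro always_eventually allI integral_nonneg_AE AE_I2) auto
    qed simp
    then have "(L \<longlongrightarrow> 0 + a * 0 - 0) (at_right 0)"
      unfolding L_def by (intro tendsto_intros mult_gamma_density_at_0 k0 gamma_cdf_tendsto_0 k1)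
    then show "(L \<longlongrightarrow> 0) (at_right 0)" by simp
    show "eventually (\<lambda>b. C \<le> L b) (at_right 0)"
      using eventually_at_right_less[of 0] by eventually_elim (rule L_ge)
  qed simp
  have C_1: "C \<le> (\<integral>x. l x \<partial>lborel)"
  proof (rule tendsto_lowerbound[where F = at_top])
    show "((\<lambda>b. \<integral>x. indicator {..b} x * l x \<partial>lborel) \<longlongrightarrow> (\<integral>x. l x \<partial>lborel)) at_top"
    proof (rule integral_dominated_convergence_at_top[where w = "\<lambda>x. \<bar>l x\<bar>"])
      show "AE x in lborel. ((\<lambda>t. indicator {..t} x * l x) \<longlongrightarrow> l x) at_top"
      proof (rule AE_I2, rule tendsto_eventually)
        fix x :: real show "eventually (\<lambda>t. indicator {..t} x * l x = l x) at_top"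
          using eventually_ge_at_top[of x] by eventually_elim simp
      qed
    qed (use int_l in \<open>auto simp: indicator_def\<close>)
    show "eventually (\<lambda>b. C \<le> (\<integral>x. indicator {..b} x * l x \<partial>lborel)) at_top"
      using eventually_gt_at_top[of 0] by eventually_elim (simp add: L_ge L_eq)
  qed simp
  \<comment> \<open>The weights that average \<open>C \<le> L b\<close> over \<open>b\<close> come
    from \<open>P (z x)\<close> itself, antitone with values in \<open>[0, 1]\<close>.\<close>
  have "C \<le> (\<integral>x. gamma_cdf k (z x) * l x \<partial>lborel)"
  proof (rule layer_cake_lower_bound)
    show "antimono (\<lambda>x. gamma_cdf k (z x))"
      using z(1) gamma_cdf_mono[OF k0] by (auto simp: antimono_def)
    fix A :: "real set" assume A: "A \<in> sets borel" "\<And>x y. x \<in> A \<Longrightarrow> y \<le> x \<Longrightarrow> y \<in> A"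
    consider "A = {}" | "A = UNIV" | w where "{..<w} \<subseteq> A" "A \<subseteq> {..w}"
      using down_closed_real_cases[of A] A(2) by metis
    then show "C \<le> (\<integral>x. indicator A x * l x \<partial>lborel)"
    proof cases
      case (3 w)
      have "AE x in lborel. indicator A x * l x = indicator {..w} x * l x"
        using AE_lborel_singleton[of w]
      proof eventually_elim
        case (elim x)
        then have "x \<in> A \<longleftrightarrow> x \<le> w" using 3 by fastforce
        then show ?case by (simp add: indicator_def)
      qed
      then have eq: "(\<integral>x. indicator A x * l x \<partial>lborel) = (\<integral>x. indicator {..w} x * l x \<partial>lborel)"
        using A(1) int_l by (intro integral_cong_AE) auto
      show ?thesis
      \<comment> \<open>An initial interval without positive points has mass 0 and falls under the
        bound for the empty set.\<close>
      proof (cases "w > 0")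
        case True
        then show ?thesis unfolding eq by (simp add: L_eq L_ge)
      next
        case False
        then have "(\<integral>x. indicator {..w} x * l x \<partial>lborel) = 0"
          by (intro integral_eq_zero_AE AE_I2) (auto simp: indicator_def l_def)
        then show ?thesis using C_0 eq by simp
      qed
    qed (use A C_0 C_1 in auto)
  qed (use int_l k0 in auto)
  also have "\<dots> = (\<integral>x. k * (gamma_cdf k (z x) * gamma_density k x) - gamma_cdf k (z x) * (x * gamma_density k x)
      + a * (gamma_cdf k (z x) * gamma_density k x) - gamma_cdf k (z x) * z x * gamma_density k x \<partial>lborel)"
    by (intro Bochner_Integration.integral_cong) (auto simp: l_def algebra_simps)
  also have "\<dots> = k * gamma_cdf k a - (\<integral>x. gamma_cdf k (z x) * (x * gamma_density k x) \<partial>lborel) + a * gamma_cdf k a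
      - (\<integral>x. gamma_cdf k (z x) * z x * gamma_density k x \<partial>lborel)"
    using int_P int_Px int_Pz by (simp add: a(2))
  finally have *: "C \<le> k * gamma_cdf k a - (\<integral>x. gamma_cdf k (z x) * (x * gamma_density k x) \<partial>lborel) + a * gamma_cdf k a
      - (\<integral>x. gamma_cdf k (z x) * z x * gamma_density k x \<partial>lborel)" .
  \<comment> \<open>When \<open>C\<close> is expanded, the integral of \<open>P (z x) * z x\<close>
    occurs on both sides of the inequality and cancels.\<close>
  have "(\<integral>x. divergence_0 k (z x) * gamma_density k x \<partial>lborel) = (\<integral>x. z x * gamma_density k (z x) * gamma_density k x
      + gamma_cdf k (z x) * z x * gamma_density k x - k * (gamma_cdf k (z x) * gamma_density k x) \<partial>lborel)"
    by (intro Bochner_Integration.integral_cong) (auto simp: divergence_0_def algebra_simps)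
  also have "\<dots> = (\<integral>x. z x * gamma_density k (z x) * gamma_density k x \<partial>lborel)
      + (\<integral>x. gamma_cdf k (z x) * z x * gamma_density k x \<partial>lborel) - k * gamma_cdf k a"
    using int_P int_Pz int_zg by (simp add: a(2))
  finally have gKI: "(\<integral>x. divergence_0 k (z x) * gamma_density k x \<partial>lborel) = \<dots>" .
  have "(\<integral>x. (z x * gamma_density k (z x) + gamma_cdf k (z x) * (k - x)) * gamma_density k x \<partial>lborel)
    = (\<integral>x. z x * gamma_density k (z x) * gamma_density k x + k * (gamma_cdf k (z x) * gamma_density k x)
        - gamma_cdf k (z x) * (x * gamma_density k x) \<partial>lborel)"
    by (intro Bochner_Integration.integral_cong) (auto simp: algebra_simps)
  also have "\<dots> = (\<integral>x. z x * gamma_density k (z x) * gamma_density k x \<partial>lborel) + k * gamma_cdf k a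
        - (\<integral>x. gamma_cdf k (z x) * (x * gamma_density k x) \<partial>lborel)"
    using int_P int_Px int_zg by (simp add: a(2))
  finally show ?thesis using * gKI by (simp add: C_def divergence_0_def[of k a] algebra_simps)
qed

end

section \<open>Dilations in dimension two\<close>

text \<open>Dominated convergence for the difference quotients, which the mean value inequality
  bounds by \<open>w\<close>.\<close>

lemma DERIV_integral_param:
  fixes f f' :: "real \<Rightarrow> 'a \<Rightarrow> real"
  assumes d: "d > 0"
    and deriv: "\<And>t x. \<bar>t - t0\<bar> < d \<Longrightarrow> ((\<lambda>t. f t x) has_real_derivative f' t x) (at t)"
    and int: "\<And>t. \<bar>t - t0\<bar> < d \<Longrightarrow> integrable M (f t)"
    and meas: "f' t0 \<in> borel_measurable M"
    and bound: "\<And>t x. \<bar>t - t0\<bar> < d \<Longrightarrow> \<bar>f' t x\<bar> \<le> w x"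
    and w: "integrable M w"
  shows "((\<lambda>t. \<integral>x. f t x \<partial>M) has_real_derivative (\<integral>x. f' t0 x \<partial>M)) (at t0)"
  unfolding has_field_derivative_iff tendsto_at_iff_sequentially comp_def
proof (intro allI impI)
  fix X :: "nat \<Rightarrow> real" assume X0: "\<forall>i. X i \<in> UNIV - {t0}" and X: "X \<longlonglongrightarrow> t0"
  have "eventually (\<lambda>i. \<bar>X i - t0\<bar> < d) sequentially"
    using X d by (simp add: tendsto_iff dist_real_def)
  then obtain N where "\<forall>n\<ge>N. \<bar>X n - t0\<bar> < d"
    unfolding eventually_sequentially by blast
  then have N: "\<bar>X (i + N) - t0\<bar> < d" for i by simp
  have "(\<lambda>i. \<integral>x. (f (X (i + N)) x - f t0 x) / (X (i + N) - t0) \<partial>M) \<longlonglongrightarrow> (\<integral>x. f' t0 x \<partial>M)"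
  proof (rule integral_dominated_convergence[where w = w])
    show "(\<lambda>x. (f (X (i + N)) x - f t0 x) / (X (i + N) - t0)) \<in> borel_measurable M" for i
      using int[OF N[of i]] int[of t0] d
      by (intro borel_measurable_divide borel_measurable_diff borel_measurable_integrable borel_measurable_const) auto
    have "(\<lambda>i. (f (X (i + N)) x - f t0 x) / (X (i + N) - t0)) \<longlonglongrightarrow> f' t0 x" for x
    proof -
      have "((\<lambda>t. (f t x - f t0 x) / (t - t0)) \<longlongrightarrow> f' t0 x) (at t0)"
        using deriv[of t0 x] d by (simp add: has_field_derivative_iff)
      then have "(\<lambda>i. (f (X i) x - f t0 x) / (X i - t0)) \<longlonglongrightarrow> f' t0 x"
        using X0 X unfolding tendsto_at_iff_sequentially comp_def by blast
      then show ?thesis by (rule LIMSEQ_ignore_initial_segment)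
    qed
    then show "AE x in M. (\<lambda>i. (f (X (i + N)) x - f t0 x) / (X (i + N) - t0)) \<longlonglongrightarrow> f' t0 x" by simp
    show "AE x in M. norm ((f (X (i + N)) x - f t0 x) / (X (i + N) - t0)) \<le> w x" for i
    proof (rule AE_I2)
      fix x
      have "norm (f (X (i + N)) x - f t0 x) \<le> w x * norm (X (i + N) - t0)"
      proof (rule field_differentiable_bound[of "ball t0 d" "\<lambda>t. f t x" "\<lambda>t. f' t x"])
        fix t assume "t \<in> ball t0 d"
        then have t: "\<bar>t - t0\<bar> < d" by (simp add: dist_real_def abs_minus_commute)
        show "((\<lambda>t. f t x) has_real_derivative f' t x) (at t within ball t0 d)"
          using deriv[OF t] by (rule has_field_derivative_at_within)
        show "norm (f' t x) \<le> w x" using bound[OF t] by simp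
      qed (use N d in \<open>auto simp: dist_real_def abs_minus_commute\<close>)
      then show "norm ((f (X (i + N)) x - f t0 x) / (X (i + N) - t0)) \<le> w x"
        using X0 by (simp add: field_simps)
    qed
  qed (use meas w in auto)
  moreover have "(\<integral>x. (f (X (i + N)) x - f t0 x) / (X (i + N) - t0) \<partial>M)
     = ((\<integral>x. f (X (i + N)) x \<partial>M) - (\<integral>x. f t0 x \<partial>M)) / (X (i + N) - t0)" for i
    using Bochner_Integration.integral_diff[OF int[OF N[of i]] int[of t0]] d by simp
  ultimately have "(\<lambda>i. ((\<integral>x. f (X (i + N)) x \<partial>M) - (\<integral>x. f t0 x \<partial>M)) / (X (i + N) - t0))
      \<longlonglongrightarrow> (\<integral>x. f' t0 x \<partial>M)" by (simp only:)
  then show "(\<lambda>i. ((\<integral>x. f (X i) x \<partial>M) - (\<integral>x. f t0 x \<partial>M)) / (X i - t0)) \<longlonglongrightarrow> (\<integral>x. f' t0 x \<partial>M)"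
    by (rule LIMSEQ_offset)
qed

text \<open>The power contributes \<open>s powr (k - 1)\<close> and the exponential only decreases.
  This yields majorants uniform in the dilation factor.\<close>

lemma gamma_density_scale_le:
  assumes k: "k \<ge> 1" and s: "s \<ge> 1"
  shows "gamma_density k (s * x) \<le> s powr (k - 1) * gamma_density k x"
proof (cases "x > 0")
  case True
  have "exp (- (s * x)) \<le> exp (- x)" using True s by simp
  then show ?thesis
    using True s k Gamma_real_pos[of k]
    by (auto simp: gamma_density_def powr_mult zero_less_mult_iff intro!: divide_right_mono mult_left_mono)
next
  case False
  then show ?thesis using s by (simp add: mult_nonneg_nonpos)
qed

section \<open>The mass of a dilated planar region as a function of the dilation factor\<close>

context
  fixes k :: real and z :: "real \<Rightarrow> real" and Z :: real
  assumes k1: "k \<ge> 1" and z: "antimono z" "\<And>x. 0 \<le> z x" "\<And>x. z x \<le> Z"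
begin

private lemma k0': "k > 0" using k1 by simp

private lemma z_meas: "z \<in> borel_measurable borel"
  by (rule antimono_borel_measurable[OF z(1)])

private lemma P_meas: "gamma_cdf k \<in> borel_measurable borel"
  by (rule gamma_cdf_measurable[OF k0'])

text \<open>The mass, under the product of two Gamma distributions, of the \<open>t\<close>-dilation
  of the region below \<open>z\<close>, after the substitution \<open>x = t * y\<close>. In this
  form \<open>t\<close> does not enter the argument of \<open>z\<close>, which may have jumps, so
  that differentiation in \<open>t\<close> is possible.\<close>

definition dilated_mass :: "real \<Rightarrow> real" where
  "dilated_mass t = (\<integral>y. gamma_cdf k (t * z y) * (t * gamma_density k (t * y)) \<partial>lborel)"

lemma rescale_integral:
  assumes "t > 0"
  shows "(\<integral>y. f (t * y) * t \<partial>lborel) = (\<integral>x. f x \<partial>lborel :: real)"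
  using lborel_integral_real_affine[of t f 0] assms by (simp add: mult.commute)

lemma dilated_mass_eq:
  assumes "t > 0"
  shows "dilated_mass t = (\<integral>x. gamma_cdf k (t * z (x / t)) * gamma_density k x \<partial>lborel)"
  using rescale_integral[OF assms, of "\<lambda>x. gamma_cdf k (t * z (x / t)) * gamma_density k x"] assms
  by (simp add: dilated_mass_def mult_ac)

lemma dilated_mass_deriv:
  assumes t: "t \<ge> 1"
  shows "(dilated_mass has_real_derivative
    (\<integral>y. z y * gamma_density k (t * z y) * (t * gamma_density k (t * y))
         + gamma_cdf k (t * z y) * ((k - t * y) * gamma_density k (t * y)) \<partial>lborel)) (at t)"
proof -
  note [measurable] = z_meas P_meas
  \<comment> \<open>For \<open>s\<close> within 1/2 of \<open>t\<close> both
    \<open>1 \<le> 2 * s\<close> and \<open>s \<le> T\<close> hold, so \<open>g (s * y)\<close> is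
    at most \<open>S\<close> times \<open>g (y / 2)\<close>, which is free of
    \<open>s\<close>.\<close>
  define T where "T = t + 1"
  define S where "S = (2 * T) powr (k - 1)"
  \<comment> \<open>The sum of the bounds for the two summands of the derivative:
    \<open>2 * k * T\<close> belongs to the first, \<open>k + T * \<bar>y\<bar>\<close> to the
    second.\<close>
  define w where "w y = S * (2 * k * T + k + T * \<bar>y\<bar>) * gamma_density k (y / 2)" for y
  note nn = gamma_density_nonneg[OF k0'] gamma_cdf_nonneg[OF k0']
  have g_le: "gamma_density k (s * y) \<le> S * gamma_density k (y / 2)" if s: "\<bar>s - t\<bar> < 1/2" for s y
  proof -
    have s': "1 \<le> 2 * s" "s \<le> T" using s t unfolding T_def by linarith+
    have "gamma_density k (s * y) = gamma_density k (2 * s * (y / 2))" by simp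
    also have "\<dots> \<le> (2 * s) powr (k - 1) * gamma_density k (y / 2)"
      using s' by (intro gamma_density_scale_le k1)
    also have "\<dots> \<le> S * gamma_density k (y / 2)"
      using s' k1 unfolding S_def by (intro mult_right_mono powr_mono2 nn) auto
    finally show ?thesis .
  qed
  have i1: "integrable lborel (\<lambda>y. gamma_density k (y / 2))"
    using lborel_integrable_real_affine[OF gamma_density_integrable[OF k0'], of "1/2" 0] by simp
  have i2: "integrable lborel (\<lambda>y. \<bar>y\<bar> * gamma_density k (y / 2))"
  proof -
    have "integrable lborel (\<lambda>y. 2 * (y / 2 * gamma_density k (y / 2)))"
      using lborel_integrable_real_affine[OF integrable_mult_gamma_density[OF k0'], of "1/2" 0]
      by (intro integrable_mult_right) simp
    moreover have "(\<lambda>y. 2 * (y / 2 * gamma_density k (y / 2))) = (\<lambda>y. \<bar>y\<bar> * gamma_density k (y / 2))"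
    proof
      show "2 * (y / 2 * gamma_density k (y / 2)) = \<bar>y\<bar> * gamma_density k (y / 2)" for y
        by (cases "y > 0") auto
    qed
    ultimately show ?thesis by (simp only:)
  qed
  have "integrable lborel (\<lambda>y. S * (2 * k * T + k) * gamma_density k (y / 2) + S * T * (\<bar>y\<bar> * gamma_density k (y / 2)))"
    by (intro Bochner_Integration.integrable_add integrable_mult_right i1 i2)
  then have w: "integrable lborel w" by (simp add: w_def[abs_def] algebra_simps)
  show ?thesis
  unfolding dilated_mass_def[abs_def]
  proof (rule DERIV_integral_param[where d = "1/2" and w = w])
  fix s y :: real assume s: "\<bar>s - t\<bar> < 1/2"
  then have s0: "s > 1/2" "s < T" using t unfolding T_def by linarith+
  \<comment> \<open>\<open>z y = 0\<close> is separate because \<open>gamma_cdf\<close> need not be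
    differentiable at 0; the function of \<open>s\<close> is then constant.\<close>
  have d1: "((\<lambda>s. gamma_cdf k (s * z y)) has_real_derivative z y * gamma_density k (s * z y)) (at s)"
  proof (cases "z y = 0")
    case False
    then have "z y > 0" using z(2)[of y] by simp
    then show ?thesis using s0
      by (intro DERIV_cong[OF DERIV_chain2[OF gamma_cdf_deriv[OF k0'] DERIV_cmult_right[OF DERIV_ident]]]) auto
  qed simp
  have d2: "((\<lambda>s. s * gamma_density k (s * y)) has_real_derivative (k - s * y) * gamma_density k (s * y)) (at s)"
  proof (cases "y > 0")
    case True
    have "((\<lambda>s. (s * y) * gamma_density k (s * y) / y) has_real_derivative (k - s * y) * gamma_density k (s * y)) (at s)"
      using s0 True
      by (intro DERIV_cong[OF DERIV_cdivide[OF DERIV_chain2[OF mult_gamma_density_deriv[OF k0'] DERIV_cmult_right[OF DERIV_ident]]]]) auto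
    then show ?thesis using True by simp
  next
    case False
    have "((\<lambda>s. s * gamma_density k (s * y)) has_real_derivative 0) (at s)"
    proof (rule has_field_derivative_transform_within_open[OF DERIV_const[of 0]])
      show "0 = s * gamma_density k (s * y)" if "s \<in> {0<..}" for s
        using that False by (simp add: mult_nonneg_nonpos)
    qed (use s0 in auto)
    moreover have "gamma_density k (s * y) = 0" using False s0 by (simp add: mult_nonneg_nonpos)
    ultimately show ?thesis by simp
  qed
  show "((\<lambda>s. gamma_cdf k (s * z y) * (s * gamma_density k (s * y))) has_real_derivative
      z y * gamma_density k (s * z y) * (s * gamma_density k (s * y))
         + gamma_cdf k (s * z y) * ((k - s * y) * gamma_density k (s * y))) (at s)"
    using DERIV_mult[OF d1 d2] by (simp add: algebra_simps)
  \<comment> \<open>\<open>mult_gamma_density_le\<close> at \<open>s * z y\<close>; the factor 2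
    pays for \<open>s > 1 / 2\<close>.\<close>
  have "\<bar>z y * gamma_density k (s * z y)\<bar> \<le> 2 * k"
  proof -
    have "s * z y * gamma_density k (s * z y) \<le> k" using s0 z(2) by (intro mult_gamma_density_le k1) auto
    moreover have "1 / 2 * (z y * gamma_density k (s * z y)) \<le> s * (z y * gamma_density k (s * z y))"
      using s0 z(2) nn by (intro mult_right_mono) auto
    ultimately show ?thesis using z(2)[of y] nn by (simp add: mult.assoc abs_mult)
  qed
  moreover have "\<bar>s * gamma_density k (s * y)\<bar> \<le> T * (S * gamma_density k (y / 2))"
    unfolding abs_mult using s0 g_le[OF s] nn by (intro mult_mono) auto
  ultimately have 1: "\<bar>z y * gamma_density k (s * z y) * (s * gamma_density k (s * y))\<bar> \<le> 2 * k * (T * (S * gamma_density k (y / 2)))"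
    unfolding abs_mult[of "z y * gamma_density k (s * z y)"] using k0' by (intro mult_mono) auto
  have "\<bar>k - s * y\<bar> \<le> k + T * \<bar>y\<bar>"
  proof -
    have "\<bar>s * y\<bar> \<le> T * \<bar>y\<bar>" unfolding abs_mult using s0 by (intro mult_right_mono) auto
    then show ?thesis using k0' by linarith
  qed
  then have "\<bar>(k - s * y) * gamma_density k (s * y)\<bar> \<le> (k + T * \<bar>y\<bar>) * (S * gamma_density k (y / 2))"
    unfolding abs_mult using g_le[OF s] nn by (intro mult_mono) auto
  then have "\<bar>gamma_cdf k (s * z y) * ((k - s * y) * gamma_density k (s * y))\<bar> \<le> 1 * ((k + T * \<bar>y\<bar>) * (S * gamma_density k (y / 2)))"
    unfolding abs_mult[of "gamma_cdf k (s * z y)"] using k0' by (intro mult_mono) auto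
  with 1 show "\<bar>z y * gamma_density k (s * z y) * (s * gamma_density k (s * y))
         + gamma_cdf k (s * z y) * ((k - s * y) * gamma_density k (s * y))\<bar> \<le> w y"
    unfolding w_def by (simp add: algebra_simps)
next
  fix s :: real assume "\<bar>s - t\<bar> < 1/2"
  then have s: "s > 0" using t by linarith
  show "integrable lborel (\<lambda>y. gamma_cdf k (s * z y) * (s * gamma_density k (s * y)))"
  proof (rule Bochner_Integration.integrable_bound[of _ "\<lambda>y. s * gamma_density k (s * y)"])
    show "integrable lborel (\<lambda>y. s * gamma_density k (s * y))"
      using lborel_integrable_real_affine[OF gamma_density_integrable[OF k0'], of s 0] s
      by (intro integrable_mult_right) simp
  qed (use s k0' in \<open>auto simp: abs_mult intro!: AE_I2 mult_left_le_one_le\<close>)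
qed (use t w in auto)
qed

text \<open>\<open>key_inequality\<close> for the dilated profile \<open>z'\<close>. The
  substitution \<open>x = t * y\<close> turns its right side into \<open>t\<close> times the
  derivative, that is, the derivative in \<open>ln t\<close>.\<close>

lemma dilated_mass_deriv_bound:
  assumes t: "t \<ge> 1" and a: "a > 0" "gamma_cdf k a = dilated_mass t"
  obtains D where "(dilated_mass has_real_derivative D) (at t)" "a * gamma_density k a \<le> t * D"
proof
  let ?f = "\<lambda>y. z y * gamma_density k (t * z y) * (t * gamma_density k (t * y))
         + gamma_cdf k (t * z y) * ((k - t * y) * gamma_density k (t * y))"
  show "(dilated_mass has_real_derivative (\<integral>y. ?f y \<partial>lborel)) (at t)"
    by (rule dilated_mass_deriv[OF t])
  define z' where "z' x = t * z (x / t)" for x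
  let ?F = "\<lambda>x. (z' x * gamma_density k (z' x) + gamma_cdf k (z' x) * (k - x)) * gamma_density k x"
  have "a * gamma_density k a \<le> (\<integral>x. ?F x \<partial>lborel)"
  proof (rule key_inequality[OF k1, where Z = "t * Z"])
    show "antimono z'" unfolding z'_def antimono_def
      using t z(1) by (auto intro!: mult_left_mono antimonoD[OF z(1)] divide_right_mono)
    show "0 \<le> z' x" "z' x \<le> t * Z" for x using t z(2,3) by (auto simp: z'_def)
    show "gamma_cdf k a = (\<integral>x. gamma_cdf k (z' x) * gamma_density k x \<partial>lborel)"
      using dilated_mass_eq[of t] t a(2) by (simp add: z'_def)
  qed fact
  also have "\<dots> = (\<integral>y. ?F (t * y) * t \<partial>lborel)"
    using rescale_integral[of t ?F] t by simp
  also have "\<dots> = (\<integral>y. t * ?f y \<partial>lborel)"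
    using t by (intro Bochner_Integration.integral_cong) (auto simp: z'_def algebra_simps)
  also have "\<dots> = t * (\<integral>y. ?f y \<partial>lborel)"
    by (rule integral_mult_right_zero)
  finally show "a * gamma_density k a \<le> t * (\<integral>y. ?f y \<partial>lborel)" .
qed

lemma integrable_dilated: "integrable lborel (\<lambda>x. gamma_cdf k (t * z (x / t)) * gamma_density k x)"
proof -
  note [measurable] = z_meas P_meas
  show ?thesis using k0' by (intro integrable_bounded_mult_gamma_density[where B = 1]) auto
qed

text \<open>The bound \<open>Z\<close> confines the dilated region to a strip of mass below 1, so
  that its mass has a quantile.\<close>

lemma dilated_mass_less_1:
  assumes t: "t > 0"
  shows "dilated_mass t < 1"
proof -
  have "dilated_mass t \<le> (\<integral>x. gamma_cdf k (t * Z) * gamma_density k x \<partial>lborel)"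
    unfolding dilated_mass_eq[OF t]
    using k0' t z(3) by (intro integral_mono integrable_dilated mult_right_mono gamma_cdf_mono mult_left_mono) auto
  also have "\<dots> = gamma_cdf k (t * Z)" using k0' by simp
  also have "\<dots> < 1" using k0' by simp
  finally show ?thesis .
qed

text \<open>Positive mass forces some \<open>y > 0\<close> with \<open>z y > 0\<close>, hence a
  rectangle inside the region, and the dilated rectangle has positive mass.\<close>

lemma dilated_mass_pos:
  assumes pos: "dilated_mass 1 > 0" and t: "t > 0"
  shows "dilated_mass t > 0"
proof -
  obtain y where y: "y > 0" "z y > 0"
  proof (rule ccontr)
    assume "\<not> thesis"
    then have "z y = 0" if "y > 0" for y using that z(2)[of y] \<open>\<And>y. y > 0 \<Longrightarrow> z y > 0 \<Longrightarrow> thesis\<close> by force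
    then have "gamma_cdf k (z x) * gamma_density k x = 0" for x by (cases "x > 0") auto
    then have "(\<integral>x. gamma_cdf k (z x) * gamma_density k x \<partial>lborel) = 0"
      by (intro integral_eq_zero_AE AE_I2)
    then have "dilated_mass 1 = 0" using dilated_mass_eq[of 1] by simp
    with pos show False by simp
  qed
  have "0 < gamma_cdf k (t * z y) * gamma_cdf k (t * y)"
    using y t k0' by (intro mult_pos_pos gamma_cdf_pos) auto
  also have "\<dots> = (\<integral>x. gamma_cdf k (t * z y) * (indicator {..t * y} x * gamma_density k x) \<partial>lborel)"
    unfolding gamma_cdf_def[of k "t * y"] by simp
  also have "\<dots> \<le> dilated_mass t"
    unfolding dilated_mass_eq[OF t]
  proof (rule integral_mono)
    fix x
    have "gamma_cdf k (t * z y) \<le> gamma_cdf k (t * z (x / t))" if "x \<le> t * y"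
      using that t k0' by (intro gamma_cdf_mono mult_left_mono antimonoD[OF z(1)]) (auto simp: field_simps)
    then show "gamma_cdf k (t * z y) * (indicator {..t * y} x * gamma_density k x) \<le> gamma_cdf k (t * z (x / t)) * gamma_density k x"
      using k0' by (auto simp: indicator_def intro!: mult_right_mono)
  qed (use integrable_dilated k0' in auto)
  finally show ?thesis .
qed

text \<open>With \<open>a s\<close> the length of the interval of mass
  \<open>dilated_mass s\<close>, the derivative bound makes \<open>a s / s\<close> nondecreasing.
  Hence \<open>a t \<ge> t * a 1 \<ge> t * q\<close>.\<close>

lemma dilated_mass_ge:
  assumes t: "t \<ge> 1" and q: "q \<ge> 0" "gamma_cdf k q \<le> (\<integral>x. gamma_cdf k (z x) * gamma_density k x \<partial>lborel)"
  shows "gamma_cdf k (t * q) \<le> (\<integral>x. gamma_cdf k (t * z (x / t)) * gamma_density k x \<partial>lborel)"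
proof (cases "q = 0")
  case True
  then show ?thesis using k0' by (auto intro!: integral_nonneg_AE AE_I2)
next
  case False
  have m1: "dilated_mass 1 = (\<integral>x. gamma_cdf k (z x) * gamma_density k x \<partial>lborel)"
    using dilated_mass_eq[of 1] by simp
  have q1: "gamma_cdf k q \<le> dilated_mass 1" using q(2) by (simp only: m1)
  have "gamma_cdf k q > 0" using q(1) False by (intro gamma_cdf_pos k0') linarith
  then have p1: "0 < dilated_mass 1" using q1 by (rule less_le_trans)
  have pos: "dilated_mass s > 0" if "s \<ge> 1" for s
    by (rule dilated_mass_pos[OF p1 less_le_trans[OF zero_less_one that]])
  have l1: "dilated_mass s < 1" if "s \<ge> 1" for s
    by (rule dilated_mass_less_1[OF less_le_trans[OF zero_less_one that]])
  define a where "a s = gamma_quantile k (dilated_mass s)" for s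
  have a0: "a s > 0" and Pa: "gamma_cdf k (a s) = dilated_mass s" if "s \<ge> 1" for s
    unfolding a_def
    by (rule gamma_quantile_pos[OF k1 pos[OF that] l1[OF that]],
        rule gamma_cdf_gamma_quantile[OF k1 less_imp_le[OF pos[OF that]] l1[OF that]])
  have "a 1 / 1 \<le> a t / t"
  proof (rule DERIV_nonneg_imp_nondecreasing[OF t])
    fix s assume s: "1 \<le> s" "s \<le> t"
    obtain D where D: "(dilated_mass has_real_derivative D) (at s)" "a s * gamma_density k (a s) \<le> s * D"
      using dilated_mass_deriv_bound[OF s(1) a0[OF s(1)] Pa[OF s(1)]] by blast
    have g: "gamma_density k (a s) > 0" using a0[OF s(1)] k0' by (rule gamma_density_pos[rotated])
    \<comment> \<open>Since \<open>a' = D / g (a s)\<close>, the bound on \<open>D\<close> reads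
      \<open>a s \<le> s * a'\<close>, which is the sign of the numerator in the quotient
      rule.\<close>
    have "(a has_real_derivative (1 / gamma_density k (a s)) * D) (at s)"
      unfolding a_def[abs_def] by (rule DERIV_chain2[OF gamma_quantile_deriv[OF k1 pos[OF s(1)] l1[OF s(1)]] D(1)])
    then have "((\<lambda>s. a s / s) has_real_derivative (1 / gamma_density k (a s) * D * s - a s * 1) / (s * s)) (at s)"
      using s by (intro DERIV_divide DERIV_ident) auto
    moreover have "a s \<le> 1 / gamma_density k (a s) * D * s" using D(2) g by (simp add: field_simps)
    then have "0 \<le> (1 / gamma_density k (a s) * D * s - a s * 1) / (s * s)"
      using s by simp
    ultimately show "\<exists>y. ((\<lambda>s. a s / s) has_real_derivative y) (at s) \<and> 0 \<le> y"
      by blast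
  qed
  then have "a 1 * t \<le> a t" using t by (subst (asm) pos_le_divide_eq) auto
  moreover have "q \<le> a 1"
    using q1 Pa[of 1] a0[of 1] q(1) by (subst gamma_cdf_le_iff[OF k0', symmetric]) auto
  ultimately have "t * q \<le> a t" using mult_right_mono[of q "a 1" t] t by (subst mult.commute) linarith
  then have "gamma_cdf k (t * q) \<le> gamma_cdf k (a t)" by (rule gamma_cdf_mono[OF k0'])
  then show ?thesis using Pa[OF t] dilated_mass_eq[of t] t by simp
qed

end

text \<open>
  \<open>dilated_cdf k t u\<close> is the mass of the \<open>t\<close>-dilation of the initial interval of mass \<open>u\<close>; the supremum
  extends this to \<open>u = 1\<close>.
\<close>

definition dilated_cdf :: "real \<Rightarrow> real \<Rightarrow> real \<Rightarrow> real" where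
  "dilated_cdf k t u = (SUP q\<in>{q. 0 \<le> q \<and> gamma_cdf k q \<le> u}. gamma_cdf k (t * q))"

section \<open>Properties of \<open>dilated_cdf\<close> and the integral inequality for antitone
  functions\<close>

lemma gamma_cdf_le_dilated_cdf:
  assumes "k > 0" "q \<ge> 0" "gamma_cdf k q \<le> u"
  shows "gamma_cdf k (t * q) \<le> dilated_cdf k t u"
  unfolding dilated_cdf_def using assms
  by (intro cSUP_upper) (auto intro!: bdd_aboveI2[where M = 1])

lemma dilated_cdf_least:
  assumes "u \<ge> 0" "\<And>q. q \<ge> 0 \<Longrightarrow> gamma_cdf k q \<le> u \<Longrightarrow> gamma_cdf k (t * q) \<le> c"
  shows "dilated_cdf k t u \<le> c"
  unfolding dilated_cdf_def
proof (rule cSUP_least)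
  have "(0 :: real) \<in> {q. 0 \<le> q \<and> gamma_cdf k q \<le> u}" using assms(1) by simp
  then show "{q. 0 \<le> q \<and> gamma_cdf k q \<le> u} \<noteq> {}" by blast
qed (use assms(2) in auto)

lemma dilated_cdf_bounds:
  assumes "k > 0" "u \<ge> 0"
  shows "0 \<le> dilated_cdf k t u" "dilated_cdf k t u \<le> 1"
  using gamma_cdf_le_dilated_cdf[of k 0 u t] dilated_cdf_least[of u k t 1] assms by auto

lemma dilated_cdf_mono:
  assumes "k > 0" "0 \<le> u" "u \<le> v"
  shows "dilated_cdf k t u \<le> dilated_cdf k t v"
  using assms by (intro dilated_cdf_least gamma_cdf_le_dilated_cdf) auto

text \<open>\<open>dilated_mass_ge\<close> with \<open>P (z x)\<close> in the role of
  \<open>h x\<close>. Quantiles exist only below mass 1, so \<open>h\<close> is first shrunk by a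
  factor \<open>c < 1\<close>, at the price of a smaller \<open>q'\<close> in place of
  \<open>q\<close>; then \<open>q'\<close> tends to \<open>q\<close>.\<close>

lemma dilated_cdf_integral_le:
  assumes k: "k \<ge> 1" and t: "t \<ge> 1"
    and h: "antimono h" "\<And>x. 0 \<le> h x" "\<And>x. h x \<le> 1"
  shows "dilated_cdf k t (\<integral>x. h x * gamma_density k x \<partial>lborel) \<le> (\<integral>x. dilated_cdf k t (h (x / t)) * gamma_density k x \<partial>lborel)"
proof (rule dilated_cdf_least)
  have k0: "k > 0" using k by simp
  have hm: "h \<in> borel_measurable borel" by (rule antimono_borel_measurable[OF h(1)])
  have int_h: "integrable lborel (\<lambda>x. h x * gamma_density k x)"
    using h(2,3) hm by (intro integrable_bounded_mult_gamma_density[OF k0, where B = 1]) auto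
  show nonneg: "0 \<le> (\<integral>x. h x * gamma_density k x \<partial>lborel)"
    using h(2) k0 by (intro integral_nonneg_AE AE_I2) auto
  fix q assume q: "q \<ge> 0" "gamma_cdf k q \<le> (\<integral>x. h x * gamma_density k x \<partial>lborel)"
  have "antimono (\<lambda>x. dilated_cdf k t (h (x / t)))"
    unfolding antimono_def using t h(2)
    by (auto intro!: dilated_cdf_mono[OF k0] antimonoD[OF h(1)] divide_right_mono)
  then have int_T: "integrable lborel (\<lambda>x. dilated_cdf k t (h (x / t)) * gamma_density k x)"
    using dilated_cdf_bounds[OF k0 h(2)] antimono_borel_measurable
    by (intro integrable_bounded_mult_gamma_density[OF k0, where B = 1]) auto
  show "gamma_cdf k (t * q) \<le> (\<integral>x. dilated_cdf k t (h (x / t)) * gamma_density k x \<partial>lborel)" (is "_ \<le> ?R")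
  proof (cases "q = 0")
    case True
    then show ?thesis using dilated_cdf_bounds[OF k0 h(2)] k0 by (auto intro!: integral_nonneg_AE AE_I2)
  next
    case False
    have less: "gamma_cdf k (t * q') \<le> ?R" if q': "0 < q'" "q' < q" for q'
    proof -
      \<comment> \<open>Chosen so that \<open>c * P q = P q'\<close>; the shrunk function then has
        mean at least \<open>P q'\<close>. Its values are at most \<open>c < 1\<close>, which
        provides the bound \<open>Z\<close>.\<close>
      define c where "c = gamma_cdf k q' / gamma_cdf k q"
      have P: "0 < gamma_cdf k q'" "gamma_cdf k q' < gamma_cdf k q"
        using q' gamma_cdf_pos[OF k0] gamma_cdf_strict_mono[OF k0] by auto
      then have c: "0 < c" "c < 1" by (auto simp: c_def)
      have ch: "0 \<le> c * h x" "c * h x \<le> c" "c * h x \<le> h x" for x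
        using c h(2)[of x] h(3)[of x] by (auto simp: mult_left_le_one_le)
      have ch1: "c * h x < 1" for x using ch(2)[of x] c(2) by linarith
      define z where "z x = gamma_quantile k (c * h x)" for x
      have Pz: "gamma_cdf k (z x) = c * h x" and z0: "z x \<ge> 0" for x
        unfolding z_def using ch[of x] ch1[of x] by (auto intro!: gamma_cdf_gamma_quantile gamma_quantile_nonneg k)
      have "gamma_cdf k (t * q') \<le> (\<integral>x. gamma_cdf k (t * z (x / t)) * gamma_density k x \<partial>lborel)"
      proof (rule dilated_mass_ge[OF k, where Z = "gamma_quantile k c"])
        show "antimono z"
          unfolding z_def antimono_def using ch ch1 c
          by (auto intro!: gamma_quantile_mono[OF k] mult_left_mono antimonoD[OF h(1)])
        show "z x \<le> gamma_quantile k c" for x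
          unfolding z_def using ch[of x] c by (intro gamma_quantile_mono[OF k]) auto
        have "gamma_cdf k q' = c * gamma_cdf k q" using P by (simp add: c_def)
        also have "\<dots> \<le> c * (\<integral>x. h x * gamma_density k x \<partial>lborel)"
          using c q(2) by (intro mult_left_mono) auto
        also have "\<dots> = (\<integral>x. gamma_cdf k (z x) * gamma_density k x \<partial>lborel)"
          by (simp add: Pz mult.assoc)
        finally show "gamma_cdf k q' \<le> (\<integral>x. gamma_cdf k (z x) * gamma_density k x \<partial>lborel)" .
      qed (use t q' z0 in auto)
      \<comment> \<open>The point \<open>z (x / t)\<close> has mass
        \<open>c * h (x / t) \<le> h (x / t)\<close>, so it is admissible in the supremum.\<close>
      also have "\<dots> \<le> ?R"
      proof (rule integral_mono)
        have "antimono (\<lambda>x. gamma_cdf k (t * z (x / t)))"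
          unfolding z_def antimono_def using ch ch1 c t
          by (auto intro!: gamma_cdf_mono[OF k0] gamma_quantile_mono[OF k] mult_left_mono antimonoD[OF h(1)] divide_right_mono)
        then show "integrable lborel (\<lambda>x. gamma_cdf k (t * z (x / t)) * gamma_density k x)"
          using k0 antimono_borel_measurable
          by (intro integrable_bounded_mult_gamma_density[OF k0, where B = 1]) auto
        fix x
        have "gamma_cdf k (t * z (x / t)) \<le> dilated_cdf k t (h (x / t))"
          using z0 ch by (intro gamma_cdf_le_dilated_cdf k0) (auto simp: Pz)
        then show "gamma_cdf k (t * z (x / t)) * gamma_density k x \<le> dilated_cdf k t (h (x / t)) * gamma_density k x"
          using k0 by (intro mult_right_mono) auto
      qed (rule int_T)
      finally show ?thesis .
    qed
    show ?thesis
    proof (rule tendsto_upperbound[where F = "at_left q" and f = "\<lambda>q'. gamma_cdf k (t * q')"])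
      have "isCont (\<lambda>q'. gamma_cdf k (t * q')) q"
        by (rule isCont_o2[OF _ gamma_cdf_isCont[OF k0]]) simp
      then show "((\<lambda>q'. gamma_cdf k (t * q')) \<longlongrightarrow> gamma_cdf k (t * q)) (at_left q)"
        by (simp add: isCont_def filterlim_at_split)
      have "eventually (\<lambda>q'. q' \<in> {0<..<q}) (at_left q)"
        using False q(1) by (intro eventually_at_left_real) auto
      then show "eventually (\<lambda>q'. gamma_cdf k (t * q') \<le> ?R) (at_left q)"
        by eventually_elim (auto intro: less)
    qed simp
  qed
qed

section \<open>Measures with a Gamma distributed power\<close>

definition gamma_measure :: "real \<Rightarrow> real measure" where
  "gamma_measure k = density lborel (\<lambda>x. ennreal (gamma_density k x))"

text \<open>The law of \<open>x\<close> symmetric with \<open>\<bar>x\<bar> powr r\<close> Gamma distributed of shape \<open>k\<close>.\<close>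

definition power_gamma_measure :: "real \<Rightarrow> real \<Rightarrow> real measure" where
  "power_gamma_measure r k = density lborel
     (\<lambda>x. ennreal (r / (2 * Gamma k) * \<bar>x\<bar> powr (r * k - 1) * exp (- (\<bar>x\<bar> powr r))))"

section \<open>Push-forward to the Gamma distribution, and the three families of measures\<close>

lemma sets_gamma_measure [simp, measurable_cong]: "sets (gamma_measure k) = sets borel"
  by (simp add: gamma_measure_def)

lemma sets_power_gamma_measure [simp, measurable_cong]: "sets (power_gamma_measure r k) = sets borel"
  by (simp add: power_gamma_measure_def)

lemma emeasure_gamma_measure_greaterThan:
  assumes k: "k > 0"
  shows "emeasure (gamma_measure k) {c<..} = ennreal (1 - gamma_cdf k c)"
proof -
  have "emeasure (gamma_measure k) {c<..} = (\<integral>\<^sup>+x. ennreal (indicator {c<..} x * gamma_density k x) \<partial>lborel)"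
    unfolding gamma_measure_def
    by (subst emeasure_density) (auto intro!: nn_integral_cong simp: indicator_def)
  also have "\<dots> = ennreal (\<integral>x. indicator {c<..} x * gamma_density k x \<partial>lborel)"
    using k by (intro nn_integral_eq_integral) auto
  also have "(\<integral>x. indicator {c<..} x * gamma_density k x \<partial>lborel)
    = (\<integral>x. gamma_density k x - indicator {..c} x * gamma_density k x \<partial>lborel)"
    by (intro Bochner_Integration.integral_cong) (auto simp: indicator_def)
  also have "\<dots> = 1 - gamma_cdf k c" using k by (simp add: gamma_cdf_def)
  finally show ?thesis .
qed

lemma nn_integral_lborel_even:
  fixes f :: "real \<Rightarrow> ennreal"
  assumes [measurable]: "f \<in> borel_measurable borel" and even: "\<And>x. f (- x) = f x"
  shows "(\<integral>\<^sup>+x. f x \<partial>lborel) = 2 * (\<integral>\<^sup>+x. f x * indicator {0<..} x \<partial>lborel)"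
proof -
  have "(\<integral>\<^sup>+x. f x \<partial>lborel) = (\<integral>\<^sup>+x. f x * indicator {0<..} x + f x * indicator {..<0} x \<partial>lborel)"
    using AE_lborel_singleton[of "0::real"]
    by (intro nn_integral_cong_AE) (auto elim!: eventually_mono simp: indicator_def)
  also have "\<dots> = (\<integral>\<^sup>+x. f x * indicator {0<..} x \<partial>lborel) + (\<integral>\<^sup>+x. f x * indicator {..<0} x \<partial>lborel)"
    by (intro nn_integral_add) auto
  also have "(\<integral>\<^sup>+x. f x * indicator {..<0} x \<partial>lborel) = (\<integral>\<^sup>+x. f x * indicator {0<..} x \<partial>lborel)"
    by (subst nn_integral_real_affine[where c = "-1" and t = 0])
       (auto intro!: nn_integral_cong simp: even indicator_def)
  finally show ?thesis by (simp add: mult_2)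
qed

text \<open>\<open>P (x powr r) / 2\<close> is a primitive of the density on the positive half-line
  and tends to 1/2 at infinity. One-sided limits admit \<open>y = 0\<close>.\<close>

lemma nn_integral_power_tail:
  assumes r: "r > 0" and k: "k > 0" and y: "y \<ge> 0"
  shows "(\<integral>\<^sup>+x. ennreal (r / (2 * Gamma k) * \<bar>x\<bar> powr (r * k - 1) * exp (- (\<bar>x\<bar> powr r))) * indicator {y<..} x \<partial>lborel)
     = ennreal ((1 - gamma_cdf k (y powr r)) / 2)"
proof -
  let ?f = "\<lambda>x. r / (2 * Gamma k) * \<bar>x\<bar> powr (r * k - 1) * exp (- (\<bar>x\<bar> powr r))"
  let ?F = "\<lambda>x. gamma_cdf k (x powr r) / 2"
  have G: "Gamma k > 0" using k by (rule Gamma_real_pos)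
  have D: "(?F has_real_derivative ?f x) (at x)" if "x > 0" for x
  proof -
    have "((\<lambda>x. gamma_cdf k (x powr r)) has_real_derivative gamma_density k (x powr r) * (r * x powr (r - 1))) (at x)"
      using that k by (intro DERIV_chain2[OF gamma_cdf_deriv] has_real_derivative_powr) auto
    moreover have "x powr (r * k - 1) = (x powr r) powr (k - 1) * x powr (r - 1)"
      by (simp add: powr_powr powr_add[symmetric] algebra_simps)
    ultimately show ?thesis
      using that by (intro DERIV_cong[OF DERIV_cdivide]) (auto simp: gamma_density_def mult_ac)
  qed
  have C: "isCont ?f x" if "x > 0" for x
    using that G by (intro continuous_intros) auto
  have A: "((?F \<circ> real_of_ereal) \<longlongrightarrow> gamma_cdf k (y powr r) / 2) (at_right (ereal y))"
    unfolding ereal_tendsto_simps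
  proof (intro tendsto_divide tendsto_const)
    have "((\<lambda>x. x powr r) \<longlongrightarrow> y powr r) (at_right y)"
      using r y by (intro tendsto_powr' tendsto_intros) (auto simp: eventually_at_filter)
    then show "((\<lambda>x. gamma_cdf k (x powr r)) \<longlongrightarrow> gamma_cdf k (y powr r)) (at_right y)"
      by (rule isCont_tendsto_compose[OF gamma_cdf_isCont[OF k]])
  qed auto
  have B: "((?F \<circ> real_of_ereal) \<longlongrightarrow> 1 / 2) (at_left \<infinity>)"
    unfolding ereal_tendsto_simps
  proof (intro tendsto_divide tendsto_const)
    have "filterlim (\<lambda>x. x powr r) at_top at_top" using r by real_asymp
    from filterlim_compose[OF gamma_cdf_at_top[OF k] this]
    show "((\<lambda>x. gamma_cdf k (x powr r)) \<longlongrightarrow> 1) at_top" .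
  qed auto
  note FTC = interval_integral_FTC_nonneg[of "ereal y" \<infinity> ?F ?f, OF _ _ _ _ A B]
  have nonneg: "0 \<le> ?f x" for x using r G by auto
  have "set_integrable lborel (einterval (ereal y) \<infinity>) ?f"
    using y by (intro FTC(1) D C AE_I2 impI nonneg) (auto intro: le_less_trans)
  then have int: "integrable lborel (\<lambda>x. indicator {y<..} x * ?f x)"
    by (simp add: set_integrable_def)
  have "(LBINT x=ereal y..\<infinity>. ?f x) = 1 / 2 - gamma_cdf k (y powr r) / 2"
    using y by (intro FTC(2) D C AE_I2 impI nonneg) (auto intro: le_less_trans)
  then have val: "(\<integral>x. indicator {y<..} x * ?f x \<partial>lborel) = (1 - gamma_cdf k (y powr r)) / 2"
    by (simp add: interval_lebesgue_integral_def set_lebesgue_integral_def diff_divide_distrib)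
  have "(\<integral>\<^sup>+x. ennreal (?f x) * indicator {y<..} x \<partial>lborel) = (\<integral>\<^sup>+x. ennreal (indicator {y<..} x * ?f x) \<partial>lborel)"
    by (intro nn_integral_cong) (auto simp: indicator_def)
  also have "\<dots> = ennreal (\<integral>x. indicator {y<..} x * ?f x \<partial>lborel)"
    by (intro nn_integral_eq_integral int AE_I2 mult_nonneg_nonneg[OF _ nonneg]) auto
  finally show ?thesis unfolding val .
qed

text \<open>The rays \<open>{c<..}\<close> determine such finite measures; evenness reduces their
  preimages to tails on the positive half-line.\<close>

lemma distr_power_gamma_measure:
  assumes r: "r > 0" and k: "k > 0"
  shows "distr (power_gamma_measure r k) borel (\<lambda>x. \<bar>x\<bar> powr r) = gamma_measure k"
proof -
  have eq: "emeasure (distr (power_gamma_measure r k) borel (\<lambda>x. \<bar>x\<bar> powr r)) {c<..} = emeasure (gamma_measure k) {c<..}" for c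
  proof -
    let ?f = "\<lambda>x. r / (2 * Gamma k) * \<bar>x\<bar> powr (r * k - 1) * exp (- (\<bar>x\<bar> powr r))"
    \<comment> \<open>\<open>max\<close> covers \<open>c < 0\<close>, where the preimage of the ray
      is everything and the tail starts at 0.\<close>
    define y where "y = max c 0 powr (1 / r)"
    have yr: "y powr r = max c 0" using r by (simp add: y_def powr_powr)
    have *: "\<bar>x\<bar> powr r > c \<longleftrightarrow> x > y" if "x > 0" for x
    proof (cases "c \<ge> 0")
      case True
      then have "c = y powr r" using yr by simp
      then show ?thesis using that r powr_less_cancel_iff
        by (metis (no_types, lifting) abs_of_pos linorder_not_less order_less_imp_le powr_less_mono2 powr_mono2 y_def powr_ge_zero)
    next
      case False
      moreover have "0 \<le> \<bar>x\<bar> powr r" by simp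
      ultimately have "\<bar>x\<bar> powr r > c" by linarith
      moreover have "y = 0" using False by (simp add: y_def)
      ultimately show ?thesis using that by simp
    qed
    have "emeasure (distr (power_gamma_measure r k) borel (\<lambda>x. \<bar>x\<bar> powr r)) {c<..}
        = emeasure (power_gamma_measure r k) {x. \<bar>x\<bar> powr r > c}"
      by (subst emeasure_distr) (auto intro!: arg_cong[where f = "emeasure _"] simp: power_gamma_measure_def)
    also have "\<dots> = (\<integral>\<^sup>+x. ennreal (?f x) * indicator {x. \<bar>x\<bar> powr r > c} x \<partial>lborel)"
      unfolding power_gamma_measure_def by (subst emeasure_density) auto
    also have "\<dots> = 2 * (\<integral>\<^sup>+x. ennreal (?f x) * indicator {x. \<bar>x\<bar> powr r > c} x * indicator {0<..} x \<partial>lborel)"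
      by (intro nn_integral_lborel_even) (auto simp: indicator_def)
    also have "(\<integral>\<^sup>+x. ennreal (?f x) * indicator {x. \<bar>x\<bar> powr r > c} x * indicator {0<..} x \<partial>lborel)
        = (\<integral>\<^sup>+x. ennreal (?f x) * indicator {y<..} x \<partial>lborel)"
    proof (intro nn_integral_cong)
      fix x :: real
      have "y \<ge> 0" by (simp add: y_def)
      then show "ennreal (?f x) * indicator {x. \<bar>x\<bar> powr r > c} x * indicator {0<..} x = ennreal (?f x) * indicator {y<..} x"
        using *[of x] by (cases "x > 0") (auto simp: indicator_def)
    qed
    also have "\<dots> = ennreal ((1 - gamma_cdf k (max c 0)) / 2)"
      using nn_integral_power_tail[OF r k, of y] yr by (simp add: y_def)
    also have "gamma_cdf k (max c 0) = gamma_cdf k c" by (cases "c \<ge> 0") auto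
    also have "2 * ennreal ((1 - gamma_cdf k c) / 2) = ennreal (2 * ((1 - gamma_cdf k c) / 2))"
      by (subst ennreal_mult') auto
    also have "2 * ((1 - gamma_cdf k c) / 2) = 1 - gamma_cdf k c" by simp
    finally show ?thesis by (simp add: emeasure_gamma_measure_greaterThan k)
  qed
  show ?thesis
    by (rule measure_eqI_lessThan) (auto simp: eq emeasure_gamma_measure_greaterThan k)
qed

lemma prob_space_power_gamma_measure:
  assumes "r > 0" "k > 0"
  shows "prob_space (power_gamma_measure r k)"
proof
  have "emeasure (power_gamma_measure r k) (space (power_gamma_measure r k)) = emeasure (distr (power_gamma_measure r k) borel (\<lambda>x. \<bar>x\<bar> powr r)) (space borel)"
    by (subst emeasure_distr) (auto simp: power_gamma_measure_def)
  also have "\<dots> = (\<integral>\<^sup>+x. ennreal (gamma_density k x) \<partial>lborel)"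
    unfolding distr_power_gamma_measure[OF assms] gamma_measure_def by (subst emeasure_density) auto
  also have "\<dots> = 1" using assms by (subst nn_integral_eq_integral) auto
  finally show "emeasure (power_gamma_measure r k) (space (power_gamma_measure r k)) = 1" .
qed

text \<open>\<open>\<Gamma>(1 + 1/p) = \<Gamma>(1/p) / p\<close> turns the constant
  \<open>\<alpha> * c_const p / 2\<close> into \<open>\<alpha> * p / (2 * Gamma (1 / p))\<close>,
  and the exponent \<open>r * k - 1\<close> is \<open>\<alpha> - 1\<close>.\<close>

lemma mu_measure_eq_power_gamma_measure:
  assumes "p > 0"
  shows "mu_measure p \<alpha> = power_gamma_measure (\<alpha> * p) (1 / p)"
proof -
  have "1 / p \<notin> \<int>\<^sub>\<le>\<^sub>0"
    using assms nonpos_Ints_nonpos[of "1 / p"] by auto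
  then have "Gamma (1 + 1 / p) = 1 / p * Gamma (1 / p)"
    using Gamma_plus1[of "1 / p"] by (simp add: add.commute)
  then show ?thesis using assms by (simp add: mu_measure_def power_gamma_measure_def c_const_def mult.commute)
qed

lemma sym_weibull_eq_power_gamma_measure: "sym_weibull \<alpha> = power_gamma_measure \<alpha> 1"
  by (simp add: sym_weibull_def power_gamma_measure_def)

lemma sym_gamma_eq_power_gamma_measure: "sym_gamma q = power_gamma_measure 1 q"
  by (simp add: sym_gamma_def power_gamma_measure_def)

section \<open>Slicing ideals\<close>

text \<open>The preimage form gives measurability and compatibility with slicing. Both sides are
  \<open>undefined\<close> outside \<open>{1..n}\<close>, so only the coordinates in
  \<open>{1..n}\<close> are compared.\<close>

lemma dilation_eq:
  assumes t: "t > 0" and L: "L \<subseteq> Rn n"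
  shows "dilation n t L = {x \<in> Rn n. (\<lambda>i\<in>{1..n}. x i / t) \<in> L}"
proof (intro set_eqI iffI)
  fix x assume "x \<in> dilation n t L"
  then obtain y where y: "y \<in> L" "x = (\<lambda>i\<in>{1..n}. t * y i)" by (auto simp: dilation_def)
  then have "(\<lambda>i\<in>{1..n}. x i / t) = y"
    using L t by (auto simp: fun_eq_iff restrict_def PiE_def extensional_def)
  then show "x \<in> {x \<in> Rn n. (\<lambda>i\<in>{1..n}. x i / t) \<in> L}" using y by auto
next
  fix x assume x: "x \<in> {x \<in> Rn n. (\<lambda>i\<in>{1..n}. x i / t) \<in> L}"
  then have "x = (\<lambda>i\<in>{1..n}. t * (\<lambda>i\<in>{1..n}. x i / t) i)"
    using t by (auto simp: fun_eq_iff restrict_def PiE_def extensional_def)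
  then show "x \<in> dilation n t L" using x unfolding dilation_def by blast
qed

lemma sets_power_measure: "sets M = sets borel \<Longrightarrow> sets (power_measure M n) = borel_sets_Rn n"
  unfolding power_measure_def borel_sets_Rn_def by (intro sets_PiM_cong) auto

lemma space_power_measure: "sets M = sets borel \<Longrightarrow> space (power_measure M n) = Rn n"
  unfolding power_measure_def by (simp add: space_PiM sets_eq_imp_space_eq)

lemma borel_sets_Rn_subset: "L \<in> borel_sets_Rn n \<Longrightarrow> L \<subseteq> Rn n"
  unfolding borel_sets_Rn_def using sets.sets_into_space[of L "\<Pi>\<^sub>M i\<in>{1..n}. (borel :: real measure)"]
  by (simp add: space_PiM)

lemma dilation_borel:
  assumes t: "t > 0" and L: "L \<in> borel_sets_Rn n"
  shows "dilation n t L \<in> borel_sets_Rn n"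
proof -
  let ?P = "\<Pi>\<^sub>M i\<in>{1..n}. (borel :: real measure)"
  have "(\<lambda>x. \<lambda>i\<in>{1..n}. x i / t) \<in> measurable ?P ?P" by measurable
  from measurable_sets[OF this, of L] L
  have "(\<lambda>x. \<lambda>i\<in>{1..n}. x i / t) -` L \<inter> space ?P \<in> sets ?P" by (simp add: borel_sets_Rn_def)
  moreover have "(\<lambda>x. \<lambda>i\<in>{1..n}. x i / t) -` L \<inter> space ?P = dilation n t L"
    unfolding dilation_eq[OF t borel_sets_Rn_subset[OF L]] by (auto simp: space_PiM)
  ultimately show ?thesis by (simp add: borel_sets_Rn_def)
qed

section \<open>Ideals, their slices, and Fubini in the last coordinate\<close>

lemma is_idealD:
  assumes "is_ideal n K" "x \<in> K" "y \<in> Rn n" "\<And>i. i \<in> {1..n} \<Longrightarrow> \<bar>y i\<bar> \<le> \<bar>x i\<bar>"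
  shows "y \<in> K"
proof -
  have "y \<in> (\<Pi>\<^sub>E i\<in>{1..n}. {- \<bar>x i\<bar> .. \<bar>x i\<bar>})"
  proof (rule PiE_I)
    fix i assume "i \<in> {1..n}"
    then show "y i \<in> {- \<bar>x i\<bar> .. \<bar>x i\<bar>}" using assms(4)[of i] by (auto simp: abs_le_iff)
  qed (use assms(3) in \<open>auto simp: PiE_def extensional_def\<close>)
  then show ?thesis using assms(1,2) unfolding is_ideal_def by blast
qed

lemma is_idealI:
  assumes "K \<subseteq> Rn n"
    and "\<And>x y. x \<in> K \<Longrightarrow> y \<in> Rn n \<Longrightarrow> (\<And>i. i \<in> {1..n} \<Longrightarrow> \<bar>y i\<bar> \<le> \<bar>x i\<bar>) \<Longrightarrow> y \<in> K"
  shows "is_ideal n K"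
  unfolding is_ideal_def
proof (intro conjI ballI subsetI)
  fix x y assume x: "x \<in> K" and y: "y \<in> (\<Pi>\<^sub>E i\<in>{1..n}. {- \<bar>x i\<bar> .. \<bar>x i\<bar>})"
  show "y \<in> K"
  proof (rule assms(2)[OF x])
    show "y \<in> Rn n" using y by (auto simp: PiE_def)
    show "\<bar>y i\<bar> \<le> \<bar>x i\<bar>" if "i \<in> {1..n}" for i
      using PiE_mem[OF y that] by (auto simp: abs_le_iff)
  qed
qed (use assms(1) in auto)

lemma is_ideal_dilation:
  assumes t: "t > 0" and K: "is_ideal n K"
  shows "is_ideal n (dilation n t K)"
proof -
  have sub: "K \<subseteq> Rn n" using K by (simp add: is_ideal_def)
  show ?thesis
    unfolding dilation_eq[OF t sub]
  proof (rule is_idealI)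
    fix x y assume x: "x \<in> {x \<in> Rn n. (\<lambda>i\<in>{1..n}. x i / t) \<in> K}" and y: "y \<in> Rn n"
      and le: "\<And>i. i \<in> {1..n} \<Longrightarrow> \<bar>y i\<bar> \<le> \<bar>x i\<bar>"
    have "(\<lambda>i\<in>{1..n}. y i / t) \<in> K"
      by (rule is_idealD[OF K, of "\<lambda>i\<in>{1..n}. x i / t"]) (use x le t in \<open>auto simp: divide_right_mono\<close>)
    then show "y \<in> {x \<in> Rn n. (\<lambda>i\<in>{1..n}. x i / t) \<in> K}" using y by simp
  qed auto
qed

text \<open>The last coordinate is fixed, so that the others are again indexed by
  \<open>{1..n}\<close> and induction applies.\<close>

definition slice :: "nat \<Rightarrow> real \<Rightarrow> (nat \<Rightarrow> real) set \<Rightarrow> (nat \<Rightarrow> real) set" where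
  "slice n x L = {y \<in> Rn n. y(Suc n := x) \<in> L}"

lemma atLeastAtMost_1_Suc: "{1..Suc n} = insert (Suc n) {1..n}"
  by auto

lemma fun_upd_Rn: "y \<in> Rn n \<Longrightarrow> y(Suc n := x) \<in> Rn (Suc n)"
  by (auto simp: PiE_def extensional_def)

text \<open>Makes the slice mass antitone in \<open>\<bar>x\<bar>\<close>, as the integral
  inequality requires.\<close>

lemma slice_antimono:
  assumes L: "is_ideal (Suc n) L" and x: "\<bar>x\<bar> \<le> \<bar>x'\<bar>"
  shows "slice n x' L \<subseteq> slice n x L"
proof
  fix y assume y: "y \<in> slice n x' L"
  have "y(Suc n := x) \<in> L"
    by (rule is_idealD[OF L, of "y(Suc n := x')"]) (use y x fun_upd_Rn in \<open>auto simp: slice_def\<close>)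
  then show "y \<in> slice n x L" using y by (simp add: slice_def)
qed

lemma slice_abs:
  assumes "is_ideal (Suc n) L"
  shows "slice n \<bar>x\<bar> L = slice n x L"
  using slice_antimono[OF assms, of x "\<bar>x\<bar>"] slice_antimono[OF assms, of "\<bar>x\<bar>" x] by auto

lemma is_ideal_slice:
  assumes L: "is_ideal (Suc n) L"
  shows "is_ideal n (slice n x L)"
proof (rule is_idealI)
  fix y y' assume y: "y \<in> slice n x L" "y' \<in> Rn n" "\<And>i. i \<in> {1..n} \<Longrightarrow> \<bar>y' i\<bar> \<le> \<bar>y i\<bar>"
  have "y'(Suc n := x) \<in> L"
    by (rule is_idealD[OF L, of "y(Suc n := x)"]) (use y fun_upd_Rn in \<open>auto simp: slice_def\<close>)
  then show "y' \<in> slice n x L" using y(2) by (simp add: slice_def)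
qed (auto simp: slice_def)

lemma slice_borel:
  assumes L: "L \<in> borel_sets_Rn (Suc n)"
  shows "slice n x L \<in> borel_sets_Rn n"
proof -
  let ?P = "\<lambda>n. \<Pi>\<^sub>M i\<in>{1..n}. (borel :: real measure)"
  have "(\<lambda>y. y(Suc n := x)) \<in> measurable (?P n) (?P (Suc n))"
    unfolding atLeastAtMost_1_Suc by (rule measurable_fun_upd[where J = "{1..n}"]) auto
  from measurable_sets[OF this, of L] L show ?thesis
    by (simp add: borel_sets_Rn_def slice_def space_PiM vimage_def Int_def conj_commute)
qed

text \<open>The origin of \<open>h (x / t)\<close> in the integral inequality.\<close>

lemma slice_dilation:
  assumes t: "t > 0" and L: "L \<subseteq> Rn (Suc n)"
  shows "slice n x (dilation (Suc n) t L) = dilation n t (slice n (x / t) L)"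
proof (rule set_eqI)
  fix y
  have sub: "slice n (x / t) L \<subseteq> Rn n" by (auto simp: slice_def)
  have Rn: "(\<lambda>i\<in>{1..n}. y i / t) \<in> Rn n" by auto
  have upd: "(\<lambda>i\<in>{1..Suc n}. (y(Suc n := x)) i / t) = (\<lambda>i\<in>{1..n}. y i / t)(Suc n := x / t)"
    by (auto simp: fun_eq_iff restrict_def)
  have "y \<in> slice n x (dilation (Suc n) t L)
      \<longleftrightarrow> y \<in> Rn n \<and> (\<lambda>i\<in>{1..Suc n}. (y(Suc n := x)) i / t) \<in> L"
    unfolding slice_def dilation_eq[OF t L] using fun_upd_Rn[of y n x] by blast
  also have "\<dots> \<longleftrightarrow> y \<in> dilation n t (slice n (x / t) L)"
    unfolding upd dilation_eq[OF t sub] using Rn by (simp only: slice_def mem_Collect_eq simp_thms)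
  finally show "y \<in> slice n x (dilation (Suc n) t L) \<longleftrightarrow> y \<in> dilation n t (slice n (x / t) L)" .
qed

lemma emeasure_power_measure_Suc:
  assumes M: "prob_space M" "sets M = sets borel" and A: "A \<in> borel_sets_Rn (Suc n)"
  shows "emeasure (power_measure M (Suc n)) A = (\<integral>\<^sup>+x. emeasure (power_measure M n) (slice n x A) \<partial>M)"
proof -
  interpret prob_space M by fact
  interpret product_sigma_finite "\<lambda>_. M" by standard
  have A': "A \<in> sets (PiM (insert (Suc n) {1..n}) (\<lambda>_. M))"
    using A sets_power_measure[OF M(2), of "Suc n"] unfolding power_measure_def atLeastAtMost_1_Suc by simp
  have "emeasure (power_measure M (Suc n)) A = (\<integral>\<^sup>+x. indicator A x \<partial>PiM (insert (Suc n) {1..n}) (\<lambda>_. M))"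
    unfolding power_measure_def atLeastAtMost_1_Suc using A' by simp
  also have "\<dots> = (\<integral>\<^sup>+x. (\<integral>\<^sup>+y. indicator A (y(Suc n := x)) \<partial>PiM {1..n} (\<lambda>_. M)) \<partial>M)"
    using A' by (intro product_nn_integral_insert_rev) auto
  also have "\<dots> = (\<integral>\<^sup>+x. emeasure (power_measure M n) (slice n x A) \<partial>M)"
  proof (intro nn_integral_cong)
    fix x
    have "(\<integral>\<^sup>+y. indicator A (y(Suc n := x)) \<partial>PiM {1..n} (\<lambda>_. M))
        = (\<integral>\<^sup>+y. indicator (slice n x A) y \<partial>power_measure M n)"
      unfolding power_measure_def
      by (intro nn_integral_cong) (auto simp: indicator_def slice_def space_PiM sets_eq_imp_space_eq[OF M(2)])
    also have "\<dots> = emeasure (power_measure M n) (slice n x A)"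
      using slice_borel[OF A] by (intro nn_integral_indicator) (simp add: sets_power_measure M)
    finally show "(\<integral>\<^sup>+y. indicator A (y(Suc n := x)) \<partial>PiM {1..n} (\<lambda>_. M))
        = emeasure (power_measure M n) (slice n x A)" .
  qed
  finally show ?thesis .
qed

lemma prob_space_power_measure: "prob_space M \<Longrightarrow> prob_space (power_measure M n)"
  unfolding power_measure_def by (intro prob_space_PiM)

text \<open>\<open>dilated_cdf_integral_le\<close> handles the last coordinate and the induction
  hypothesis the slices. Using \<open>dilated_cdf\<close> in place of a strip of equal mass also
  covers slices of full mass, to which no strip corresponds.\<close>

lemma emeasure_dilation_ideal_ge:
  assumes r: "r > 0" and k: "k \<ge> 1" and t: "t \<ge> 1"
    and L: "L \<in> borel_sets_Rn n" "is_ideal n L"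
  shows "ennreal (dilated_cdf k (t powr r) (measure (power_measure (power_gamma_measure r k) n) L))
    \<le> emeasure (power_measure (power_gamma_measure r k) n) (dilation n t L)"
  using L
proof (induction n arbitrary: L)
  \<comment> \<open>The space is a single point, so \<open>L\<close> has mass 0 or 1.\<close>
  case 0
  have Rn0: "Rn 0 = {\<lambda>_. undefined}" by simp
  interpret prob_space "power_measure (power_gamma_measure r k) 0"
    using r k by (intro prob_space_power_measure prob_space_power_gamma_measure) auto
  consider "L = {}" | "L = Rn 0"
    using borel_sets_Rn_subset[OF 0(1)] unfolding Rn0 by blast
  then show ?case
  proof cases
    case 1
    have "dilated_cdf k (t powr r) 0 \<le> 0"
    proof (rule dilated_cdf_least)
      fix q assume "q \<ge> 0" "gamma_cdf k q \<le> 0"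
      then have "q = 0" using gamma_cdf_pos[of k q] k by (cases "q = 0") auto
      then show "gamma_cdf k (t powr r * q) \<le> 0" by simp
    qed simp
    then show ?thesis using 1 by (simp add: ennreal_neg)
  next
    case 2
    then have "dilation 0 t L = space (power_measure (power_gamma_measure r k) 0)"
      by (auto simp: dilation_def space_power_measure)
    then have "emeasure (power_measure (power_gamma_measure r k) 0) (dilation 0 t L) = 1"
      using emeasure_space_1 by simp
    moreover have "dilated_cdf k (t powr r) (measure (power_measure (power_gamma_measure r k) 0) L) \<le> 1"
      using k by (intro dilated_cdf_bounds) auto
    ultimately show ?thesis by (simp add: ennreal_le_1)
  qed
next
  case (Suc n)
  define M where "M = power_gamma_measure r k"
  define N where "N = power_measure M n"
  \<comment> \<open>Multiplying \<open>x\<close> by \<open>t\<close> multiplies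
    \<open>\<bar>x\<bar> powr r\<close> by \<open>t powr r\<close>.\<close>
  define \<tau> where "\<tau> = t powr r"
  have k0: "k > 0" using k by simp
  have t0: "t > 0" using t by simp
  have \<tau>: "\<tau> \<ge> 1" using t r by (simp add: \<tau>_def ge_one_powr_ge_zero)
  have M: "prob_space M" "sets M = sets borel" using r k0 by (auto simp: M_def prob_space_power_gamma_measure)
  interpret M: prob_space M by fact
  interpret N: prob_space N unfolding N_def by (rule prob_space_power_measure[OF M(1)])
  have distr: "distr M borel (\<lambda>x. \<bar>x\<bar> powr r) = gamma_measure k" unfolding M_def by (rule distr_power_gamma_measure[OF r k0])
  have transfer: "(\<integral>\<^sup>+x. ennreal (f (\<bar>x\<bar> powr r)) \<partial>M) = ennreal (\<integral>x. f x * gamma_density k x \<partial>lborel)"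
    if f: "f \<in> borel_measurable borel" "\<And>x. 0 \<le> f x" "\<And>x. f x \<le> 1" for f
  proof -
    have "(\<integral>\<^sup>+x. ennreal (f (\<bar>x\<bar> powr r)) \<partial>M) = (\<integral>\<^sup>+x. ennreal (f x) \<partial>distr M borel (\<lambda>x. \<bar>x\<bar> powr r))"
      using f M(2) by (subst nn_integral_distr) (auto cong: measurable_cong_sets)
    also have "\<dots> = (\<integral>\<^sup>+x. ennreal (gamma_density k x) * ennreal (f x) \<partial>lborel)"
      unfolding distr gamma_measure_def using f by (subst nn_integral_density) auto
    also have "\<dots> = (\<integral>\<^sup>+x. ennreal (f x * gamma_density k x) \<partial>lborel)"
      using f k0 by (intro nn_integral_cong) (simp add: ennreal_mult' mult.commute)
    also have "\<dots> = ennreal (\<integral>x. f x * gamma_density k x \<partial>lborel)"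
      using f k0 by (intro nn_integral_eq_integral integrable_bounded_mult_gamma_density[where B = 1]) auto
    finally show ?thesis .
  qed
  \<comment> \<open>The slice mass in terms of the Gamma variable
    \<open>u = \<bar>x\<bar> powr r\<close>; \<open>max\<close> extends it to negative
    \<open>u\<close> so that it is antitone on the whole line.\<close>
  define h where "h u = measure N (slice n (max 0 u powr (1 / r)) L)" for u
  have sl: "slice n x L \<in> sets N" for x
    using slice_borel[OF Suc.prems(1)] by (simp add: N_def sets_power_measure M)
  have h_abs: "measure N (slice n x L) = h (\<bar>x\<bar> powr r)" for x
    using r slice_abs[OF Suc.prems(2), of x] by (simp add: h_def powr_powr)
  have h_anti: "antimono h"
    unfolding h_def antimono_def using r sl
    by (auto intro!: N.finite_measure_mono slice_antimono[OF Suc.prems(2)] powr_mono2)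
  have h01: "0 \<le> h u" "h u \<le> 1" for u by (auto simp: h_def)
  have hm: "h \<in> borel_measurable borel" by (rule antimono_borel_measurable[OF h_anti])
  have "emeasure (power_measure M (Suc n)) L = (\<integral>\<^sup>+x. ennreal (h (\<bar>x\<bar> powr r)) \<partial>M)"
    unfolding emeasure_power_measure_Suc[OF M Suc.prems(1)]
    by (intro nn_integral_cong) (simp add: N_def[symmetric] N.emeasure_eq_measure h_abs)
  also have "\<dots> = ennreal (\<integral>x. h x * gamma_density k x \<partial>lborel)"
    by (rule transfer[OF hm h01])
  finally have meas: "measure (power_measure M (Suc n)) L = (\<integral>x. h x * gamma_density k x \<partial>lborel)"
    unfolding measure_def using h01 k0 by (simp add: integral_nonneg_AE)
  have dil_anti: "antimono (\<lambda>u. dilated_cdf k \<tau> (h (u / \<tau>)))"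
    unfolding antimono_def using \<tau> h01
    by (auto intro!: dilated_cdf_mono[OF k0] antimonoD[OF h_anti] divide_right_mono)
  have "ennreal (dilated_cdf k \<tau> (measure (power_measure M (Suc n)) L))
      \<le> ennreal (\<integral>x. dilated_cdf k \<tau> (h (x / \<tau>)) * gamma_density k x \<partial>lborel)"
    unfolding meas by (intro ennreal_leI dilated_cdf_integral_le k \<tau> h_anti h01)
  also have "\<dots> = (\<integral>\<^sup>+x. ennreal (dilated_cdf k \<tau> (h (\<bar>x\<bar> powr r / \<tau>))) \<partial>M)"
    by (rule transfer[symmetric])
       (use antimono_borel_measurable[OF dil_anti] dilated_cdf_bounds[OF k0 h01(1)] in auto)
  also have "\<dots> = (\<integral>\<^sup>+x. ennreal (dilated_cdf k \<tau> (measure N (slice n (x / t) L))) \<partial>M)"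
    using t0 by (intro nn_integral_cong) (simp add: h_abs \<tau>_def powr_divide)
  also have "\<dots> \<le> (\<integral>\<^sup>+x. emeasure N (dilation n t (slice n (x / t) L)) \<partial>M)"
    unfolding N_def M_def \<tau>_def
    by (intro nn_integral_mono Suc.IH slice_borel is_ideal_slice Suc.prems)
  also have "\<dots> = emeasure (power_measure M (Suc n)) (dilation (Suc n) t L)"
    unfolding emeasure_power_measure_Suc[OF M dilation_borel[OF t0 Suc.prems(1)]]
    by (simp add: slice_dilation[OF t0 borel_sets_Rn_subset[OF Suc.prems(1)]] N_def)
  finally show ?case by (simp add: M_def \<tau>_def)
qed

text \<open>A strip is a box with one nontrivial side, which is an initial interval for the Gamma
  variable.\<close>

lemma emeasure_strip:
  assumes r: "r > 0" and k: "k > 0" and n: "n \<ge> 1" and w: "w \<ge> 0"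
  shows "emeasure (power_measure (power_gamma_measure r k) n) (strip n w) = ennreal (gamma_cdf k (w powr r))"
proof -
  interpret prob_space "power_gamma_measure r k" using r k by (rule prob_space_power_gamma_measure)
  interpret product_sigma_finite "\<lambda>_. power_gamma_measure r k" by standard
  let ?A = "\<lambda>i::nat. if i = 1 then {x::real. \<bar>x\<bar> \<le> w} else UNIV"
  have strip: "strip n w = (\<Pi>\<^sub>E i\<in>{1..n}. ?A i)"
    using n by (fastforce simp: strip_def PiE_def Pi_def extensional_def split: if_splits)
  have space: "space (power_gamma_measure r k) = UNIV" by (simp add: power_gamma_measure_def)
  have "emeasure (power_measure (power_gamma_measure r k) n) (strip n w) = (\<Prod>i\<in>{1..n}. emeasure (power_gamma_measure r k) (?A i))"
    unfolding strip power_measure_def by (intro emeasure_PiM) auto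
  also have "\<dots> = (\<Prod>i\<in>{1..n}. if i = 1 then emeasure (power_gamma_measure r k) {x. \<bar>x\<bar> \<le> w} else 1)"
    using emeasure_space_1 unfolding space by (intro prod.cong) auto
  also have "\<dots> = emeasure (power_gamma_measure r k) {x. \<bar>x\<bar> \<le> w}"
    using n by (simp add: prod.delta)
  also have "{x. \<bar>x\<bar> \<le> w} = {x. \<bar>x\<bar> powr r \<le> w powr r}"
  proof -
    have "\<bar>x\<bar> \<le> w \<longleftrightarrow> \<bar>x\<bar> powr r \<le> w powr r" for x
      using w r powr_mono2[of r "\<bar>x\<bar>" w] powr_less_mono2[of r w "\<bar>x\<bar>"] by force
    then show ?thesis by simp
  qed
  also have "emeasure (power_gamma_measure r k) {x. \<bar>x\<bar> powr r \<le> w powr r} = emeasure (distr (power_gamma_measure r k) borel (\<lambda>x. \<bar>x\<bar> powr r)) {..w powr r}"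
  proof -
    have meas: "(\<lambda>x. \<bar>x\<bar> powr r) \<in> borel_measurable (power_gamma_measure r k)" by measurable
    show ?thesis
      using emeasure_distr[OF meas, of "{..w powr r}"] by (simp add: space vimage_def)
  qed
  also have "\<dots> = (\<integral>\<^sup>+x. ennreal (indicator {..w powr r} x * gamma_density k x) \<partial>lborel)"
    unfolding distr_power_gamma_measure[OF r k] gamma_measure_def
    by (subst emeasure_density) (auto intro!: nn_integral_cong simp: indicator_def)
  also have "\<dots> = ennreal (gamma_cdf k (w powr r))"
    unfolding gamma_cdf_def using k by (intro nn_integral_eq_integral) auto
  finally show ?thesis .
qed

lemma dilation_strip:
  assumes "t > 0" "n \<ge> 1"
  shows "dilation n t (strip n w) = strip n (t * w)"
  using assms by (subst dilation_eq) (auto simp: strip_def field_simps)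

lemma power_gamma_measure_supports_S_inequality:
  assumes r: "r > 0" and k: "k \<ge> 1" and n: "n \<ge> 1"
  shows "supports_S_inequality_for_ideals (power_gamma_measure r k) n"
  unfolding supports_S_inequality_for_ideals_def supports_S_inequality_def
proof (intro ballI impI allI)
  fix L s w t
  assume L: "L \<in> borel_sets_Rn n" "is_ideal n L" and s: "0 < (s::real)" and w: "0 \<le> (w::real)"
    and eq: "emeasure (power_measure (power_gamma_measure r k) n) (dilation n s L) = emeasure (power_measure (power_gamma_measure r k) n) (strip n w)"
    and t: "1 \<le> (t::real)"
  let ?N = "power_measure (power_gamma_measure r k) n"
  have k0: "k > 0" using k by simp
  have "measure ?N (dilation n s L) = gamma_cdf k (w powr r)"
    using eq emeasure_strip[OF r k0 n w] k0 by (simp add: measure_def)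
  \<comment> \<open>\<open>q = w powr r\<close> is admissible in the supremum, its mass being that
    of the dilated set.\<close>
  then have "gamma_cdf k (t powr r * w powr r) \<le> dilated_cdf k (t powr r) (measure ?N (dilation n s L))"
    using k0 by (intro gamma_cdf_le_dilated_cdf) auto
  then have "ennreal (gamma_cdf k ((t * w) powr r)) \<le> ennreal (dilated_cdf k (t powr r) (measure ?N (dilation n s L)))"
    using t w by (intro ennreal_leI) (simp add: powr_mult)
  also have "\<dots> \<le> emeasure ?N (dilation n t (dilation n s L))"
    by (intro emeasure_dilation_ideal_ge r k t dilation_borel is_ideal_dilation s L)
  finally show "emeasure ?N (dilation n t (strip n w)) \<le> emeasure ?N (dilation n t (dilation n s L))"
    using t w n emeasure_strip[OF r k0 n, of "t * w"] by (simp add: dilation_strip)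
qed

theorem corollary1:
  fixes n :: nat
  assumes "n \<ge> 1"
  shows "(\<forall>p \<alpha> :: real. 0 < p \<longrightarrow> p \<le> 1 \<longrightarrow> 0 < \<alpha> \<longrightarrow>
            supports_S_inequality_for_ideals (mu_measure p \<alpha>) n) \<and>
         (\<forall>\<alpha> :: real. 0 < \<alpha> \<longrightarrow> supports_S_inequality_for_ideals (sym_weibull \<alpha>) n) \<and>
         (\<forall>q :: real. 1 \<le> q \<longrightarrow> supports_S_inequality_for_ideals (sym_gamma q) n)"
  using assms
  \<comment> \<open>The parameters \<open>(r, k)\<close> are \<open>(\<alpha> * p, 1 / p)\<close>,
    \<open>(\<alpha>, 1)\<close> and \<open>(1, q)\<close>; the shape is at least 1 in each
    case.\<close>
  by (auto simp: mu_measure_eq_power_gamma_measure sym_weibull_eq_power_gamma_measure sym_gamma_eq_power_gamma_measure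
      intro!: power_gamma_measure_supports_S_inequality)

end
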